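(* Let $G=C_3\times C_4=\langle g\rangle\times\langle h\rangle$, where $g$ has order $3$ and $h$ has order $4$. (a) The supercharacter theory of $G$ whose superclasses are the conjugacy classes of $G$ belongs to $\mathrm{Sup}^{*}(G)\cap\mathrm{AutSup}(G)$ but not to $\mathrm{NSup}(G)$. Hence $\mathrm{Sup}^{*}(G)\cap\mathrm{AutSup}(G)$ is not a subset of $\mathrm{NSup}(G)$. (b) Let $S=\{\langle g\rangle\times 1,\ 1\times\langle h\rangle\}$. The normal supercharacter theory of $G$ generated by $S$ has superclasses $$\{1\},\quad \{(g,1),(g^2,1)\},\quad \{(1,h),(1,h^2),(1,h^3)\},\quad \{(g,h),(g,h^2),(g,h^3),(g^2,h),(g^2,h^2),(g^2,h^3)\},$$ and it does not belong to $\mathrm{AutSup}(G)\cup\mathrm{ACSup}(G)\cup\mathrm{Sup}^{*}(G)$.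
   Context: For a finite group $G$, $\mathrm{Irr}(G)$ is the set of irreducible complex characters. A supercharacter theory of $G$ is a pair $(\mathcal{X},\mathcal{K})$ together with a choice of characters $\{\chi_X:X\in\mathcal{X}\}$ (each $\chi_X$ a constant multiple of $\sum_{\psi\in X}\psi(1)\psi$), where $\mathcal{X}$ is a partition of $\mathrm{Irr}(G)$ and $\mathcal{K}$ is a partition of $G$ (its members are called superclasses), such that $\{1\}\in\mathcal{K}$, $|\mathcal{X}|=|\mathcal{K}|$, and each $\chi_X$ is constant on the parts of $\mathcal{K}$. $\mathrm{Sup}(G)$ is the set of all supercharacter theories of $G$. Normal supercharacter theory. Let $N(G)$ be the set of all normal subgroups of $G$. For $S\subseteq N(G)$, $A(S)$ is the smallest subset of $N(G)$ containing $S$, $\{1\}$, $G$ and closed under products $NH$ and intersections. For $N\in A(S)$ (with $\subset$ strict inclusion) put $N^\circ:=N\setminus\bigcup_{H\in A(S),H\subset N}H$, $\mathcal{X}^N:=\{\psi\in\mathrm{Irr}(G):N\subseteq\ker\psi\}$, $\mathcal{X}^{N^\bullet}:=\mathcal{X}^N\setminus\bigcup_{K\in A(S),N\subset K}\mathcal{X}^K$. The normal supercharacter theory generated by $S$ is the supercharacter theory $(\{\mathcal{X}^{N^\bullet}\ne\emptyset:N\in A(S)\},\{N^\circ\neq\emptyset:N\in A(S)\})$. $\mathrm{NSup}(G)$ is the set of all normal supercharacter theories of $G$, as $S$ ranges over subsets of $N(G)$. $\mathrm{AutSup}(G)$: the set of supercharacter theories $(\mathcal{X},\mathcal{K})$ obtained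 from a finite group $A$ acting on $G$ via automorphisms, where $\mathcal{X}$ is the set of $A$-orbits on $\mathrm{Irr}(G)$ and the members of $\mathcal{K}$ are the unions of the $A$-orbits on the conjugacy classes of $G$ (one member for each orbit). $\mathrm{ACSup}(G)$: the set of supercharacter theories obtained from a group $A$ of automorphisms of the cyclotomic field $\mathbb{Q}[\zeta_{|G|}]$, $\zeta_{|G|}$ a primitive $|G|$th root of unity. Here $A$ acts on $\mathrm{Irr}(G)$ by acting on character values, and $\sigma\in A$ with $\sigma(\zeta_{|G|})=\zeta_{|G|}^r$ sends the class of $x\in G$ to the class of $x^r$; $\mathcal{X}$ is the set of $A$-orbits on $\mathrm{Irr}(G)$ and $\mathcal{K}$ is the set of unions of the various $A$-orbits on conjugacy classes (one member for each orbit). $\mathrm{Sup}^*(G)$: for a normal subgroup $N$ of $G$, let $\mathrm{Sup}_G(N)$ be the set of supercharacter theories $(\mathcal{X},\mathcal{K})$ of $N$ such that conjugation by $G$ fixes each $K\in\mathcal{K}$ setwise. For $(\mathcal{X},\mathcal{K})\in\mathrm{Sup}_G(N)$ and $(\mathcal{Y},\mathcal{L})\in\mathrm{Sup}(G/N)$, their $*_N$-product is the supercharacter theory $$\left(\{Z^G: Z\in\mathcal{X},\,Z\neq\{1_N\}\}\cup\mathcal{Y},\ \ \mathcal{K}\cup\{\widetilde{L}:L\in\mathcal{L},\,L\neq\{N\}\}\right)$$ of $G$, where $1_N$ is the principal character of $N$; $Z^G$ is the set of $\chi\in\mathrm{Irr}(G)$ whose restriction to $N$ has some $\psi\in Z$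 as a constituent; members of $\mathcal{Y}$ are viewed as sets of characters of $G$ by lifting from $G/N$; and $\widetilde{L}=\bigcup_{Nx\in L}Nx$. $\mathrm{Sup}^*_N(G)$ is the set of all such products for given $N$, and $\mathrm{Sup}^*(G)=\bigcup_{N\in N(G)}\mathrm{Sup}^*_N(G)$, the union being over all normal subgroups $N$ of $G$.
   Formalization: In (b), "does not belong to Sup*(G)" is stated as: not in Sup*_N(G) for any normal subgroup N other than 1 and G, because with N = 1 or N = G allowed every supercharacter theory of G lies in Sup*(G); part (a) keeps all normal N. *)

theory Defs
  imports
    "HOL-Library.Disjoint_Sets"
    "HOL-Algebra.Bij"
    "HOL-Algebra.Generated_Groups"
    "HOL-Algebra.Group_Action"
    "HOL-Algebra.Multiplicative_Group"
    "HOL-Algebra.QuotRing"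
    "HOL-Computational_Algebra.Polynomial"
    "Jordan_Normal_Form.Matrix"
begin

section \<open>Complex characters of a finite group\<close>

text \<open>Representations are nonzero and of arbitrary finite degree. Characters are extensional
  functions on the carrier, so that equality of characters is equality of functions.\<close>

definition matrix_rep :: "('a, 'b) monoid_scheme \<Rightarrow> nat \<Rightarrow> ('a \<Rightarrow> complex mat) \<Rightarrow> bool" where
  "matrix_rep G n \<rho> \<longleftrightarrow> n > 0 \<and> (\<forall>x\<in>carrier G. \<rho> x \<in> carrier_mat n n) \<and>
     \<rho> \<one>\<^bsub>G\<^esub> = 1\<^sub>m n \<and> (\<forall>x\<in>carrier G. \<forall>y\<in>carrier G. \<rho> (x \<otimes>\<^bsub>G\<^esub> y) = \<rho> x * \<rho> y)"

definition mat_trace :: "complex mat \<Rightarrow> complex" where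
  "mat_trace M = (\<Sum>i<dim_row M. M $$ (i, i))"

definition char_of_rep :: "('a, 'b) monoid_scheme \<Rightarrow> ('a \<Rightarrow> complex mat) \<Rightarrow> 'a \<Rightarrow> complex" where
  "char_of_rep G \<rho> = (\<lambda>x\<in>carrier G. mat_trace (\<rho> x))"

definition invariant_subspace ::
    "('a, 'b) monoid_scheme \<Rightarrow> nat \<Rightarrow> ('a \<Rightarrow> complex mat) \<Rightarrow> complex vec set \<Rightarrow> bool" where
  "invariant_subspace G n \<rho> W \<longleftrightarrow> W \<subseteq> carrier_vec n \<and> 0\<^sub>v n \<in> W \<and>
     (\<forall>v\<in>W. \<forall>w\<in>W. v + w \<in> W) \<and> (\<forall>c. \<forall>v\<in>W. c \<cdot>\<^sub>v v \<in> W) \<and>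
     (\<forall>x\<in>carrier G. \<forall>v\<in>W. \<rho> x *\<^sub>v v \<in> W)"

definition irreducible_rep :: "('a, 'b) monoid_scheme \<Rightarrow> nat \<Rightarrow> ('a \<Rightarrow> complex mat) \<Rightarrow> bool" where
  "irreducible_rep G n \<rho> \<longleftrightarrow> matrix_rep G n \<rho> \<and>
     (\<forall>W. invariant_subspace G n \<rho> W \<longrightarrow> W = {0\<^sub>v n} \<or> W = carrier_vec n)"

definition characters :: "('a, 'b) monoid_scheme \<Rightarrow> ('a \<Rightarrow> complex) set" where
  "characters G = {char_of_rep G \<rho> | n \<rho>. matrix_rep G n \<rho>}"

definition Irr :: "('a, 'b) monoid_scheme \<Rightarrow> ('a \<Rightarrow> complex) set" where
  "Irr G = {char_of_rep G \<rho> | n \<rho>. irreducible_rep G n \<rho>}"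

definition principal_char :: "('a, 'b) monoid_scheme \<Rightarrow> 'a \<Rightarrow> complex" where
  "principal_char G = (\<lambda>x\<in>carrier G. 1)"

definition char_kernel :: "('a, 'b) monoid_scheme \<Rightarrow> ('a \<Rightarrow> complex) \<Rightarrow> 'a set" where
  "char_kernel G \<psi> = {x \<in> carrier G. \<psi> x = \<psi> \<one>\<^bsub>G\<^esub>}"

definition constituent :: "('a, 'b) monoid_scheme \<Rightarrow> ('a \<Rightarrow> complex) \<Rightarrow> ('a \<Rightarrow> complex) \<Rightarrow> bool" where
  "constituent G \<psi> \<theta> \<longleftrightarrow> \<psi> \<in> Irr G \<and>
     (\<exists>m :: ('a \<Rightarrow> complex) \<Rightarrow> nat. m \<psi> > 0 \<and>
        (\<forall>x\<in>carrier G. \<theta> x = (\<Sum>\<phi>\<in>Irr G. of_nat (m \<phi>) * \<phi> x)))"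

definition conj_class :: "('a, 'b) monoid_scheme \<Rightarrow> 'a \<Rightarrow> 'a set" where
  "conj_class G x = {y \<otimes>\<^bsub>G\<^esub> x \<otimes>\<^bsub>G\<^esub> inv\<^bsub>G\<^esub> y | y. y \<in> carrier G}"

definition conj_classes :: "('a, 'b) monoid_scheme \<Rightarrow> 'a set set" where
  "conj_classes G = conj_class G ` carrier G"


section \<open>Supercharacter theories\<close>

text \<open>A theory is identified with its pair of partitions. The supercharacters enter
  existentially: the constant multiples are not fixed. They are nonzero, as elements of
  \<^const>\<open>characters\<close> have positive degree.\<close>

type_synonym 'a sct = "('a \<Rightarrow> complex) set set \<times> 'a set set"

definition SupTh :: "('a, 'b) monoid_scheme \<Rightarrow> 'a sct set" where
  "SupTh G = {(XX, KK).
     partition_on (Irr G) XX \<and> partition_on (carrier G) KK \<and>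
     {\<one>\<^bsub>G\<^esub>} \<in> KK \<and> card XX = card KK \<and>
     (\<exists>sc. \<forall>X\<in>XX. sc X \<in> characters G \<and>
        (\<exists>c. \<forall>x\<in>carrier G. sc X x = c * (\<Sum>\<psi>\<in>X. \<psi> \<one>\<^bsub>G\<^esub> * \<psi> x)) \<and>
        (\<forall>K\<in>KK. \<forall>x\<in>K. \<forall>y\<in>K. sc X x = sc X y))}"


subsection \<open>Normal supercharacter theories\<close>

inductive_set normal_closure_system :: "('a, 'b) monoid_scheme \<Rightarrow> 'a set set \<Rightarrow> 'a set set"
  for G (structure) and S where
  base: "N \<in> S \<Longrightarrow> N \<in> normal_closure_system G S"
| triv: "{\<one>} \<in> normal_closure_system G S"
| top: "carrier G \<in> normal_closure_system G S"
| prod: "\<lbrakk>N \<in> normal_closure_system G S; H \<in> normal_closure_system G S\<rbrakk>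
    \<Longrightarrow> N <#> H \<in> normal_closure_system G S"
| inter: "\<lbrakk>N \<in> normal_closure_system G S; H \<in> normal_closure_system G S\<rbrakk>
    \<Longrightarrow> N \<inter> H \<in> normal_closure_system G S"

definition normal_circ :: "('a, 'b) monoid_scheme \<Rightarrow> 'a set set \<Rightarrow> 'a set \<Rightarrow> 'a set" where
  "normal_circ G S N = N - \<Union>{H \<in> normal_closure_system G S. H \<subset> N}"

definition chars_over :: "('a, 'b) monoid_scheme \<Rightarrow> 'a set \<Rightarrow> ('a \<Rightarrow> complex) set" where
  "chars_over G N = {\<psi> \<in> Irr G. N \<subseteq> char_kernel G \<psi>}"

definition chars_bullet ::
    "('a, 'b) monoid_scheme \<Rightarrow> 'a set set \<Rightarrow> 'a set \<Rightarrow> ('a \<Rightarrow> complex) set" where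
  "chars_bullet G S N =
     chars_over G N - (\<Union>K\<in>{K \<in> normal_closure_system G S. N \<subset> K}. chars_over G K)"

definition normal_sct :: "('a, 'b) monoid_scheme \<Rightarrow> 'a set set \<Rightarrow> 'a sct" where
  "normal_sct G S =
     ({chars_bullet G S N | N. N \<in> normal_closure_system G S \<and> chars_bullet G S N \<noteq> {}},
      {normal_circ G S N | N. N \<in> normal_closure_system G S \<and> normal_circ G S N \<noteq> {}})"

definition NSup :: "('a, 'b) monoid_scheme \<Rightarrow> 'a sct set" where
  "NSup G = {normal_sct G S | S. S \<subseteq> {N. N \<lhd> G}}"


subsection \<open>Theories from automorphisms\<close>

text \<open>Every finite group has an isomorphic copy on a finite set of naturals, so letting the acting
  group range over \<^typ>\<open>nat monoid\<close> loses nothing.\<close>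

definition AutSup :: "('a, 'b) monoid_scheme \<Rightarrow> 'a sct set" where
  "AutSup G =
     {(orbits A (Irr G) (\<lambda>a \<theta>. \<lambda>x\<in>carrier G. \<theta> (\<phi> (inv\<^bsub>A\<^esub> a) x)),
       {\<Union>Q | Q. Q \<in> orbits A (conj_classes G) (\<lambda>a C. \<phi> a ` C)})
      | (A :: nat monoid) \<phi>. group A \<and> finite (carrier A) \<and> \<phi> \<in> hom A (AutoGroup G)}"


subsection \<open>Theories from automorphisms of a cyclotomic field\<close>

definition root_of_unity :: "nat \<Rightarrow> complex" where
  "root_of_unity n = cis (2 * pi / real n)"

definition cyclotomic_field :: "nat \<Rightarrow> complex ring" where
  "cyclotomic_field n =
     \<lparr>carrier = {poly (map_poly of_rat p) (root_of_unity n) | p :: rat poly. True},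
      monoid.mult = (*), one = 1, zero = 0, add = (+)\<rparr>"

text \<open>The exponent matters only modulo \<open>n\<close>; taking the least one just fixes a representative.\<close>

definition cyclotomic_exponent :: "nat \<Rightarrow> (complex \<Rightarrow> complex) \<Rightarrow> nat" where
  "cyclotomic_exponent n \<sigma> = (LEAST r. \<sigma> (root_of_unity n) = root_of_unity n ^ r)"

definition ACSup :: "('a, 'b) monoid_scheme \<Rightarrow> 'a sct set" where
  "ACSup G =
     (let F = cyclotomic_field (Coset.order G); B = BijGroup (carrier F) in
      {(orbits (B\<lparr>carrier := A\<rparr>) (Irr G) (\<lambda>\<sigma> \<theta>. \<lambda>x\<in>carrier G. \<sigma> (\<theta> x)),
        {\<Union>Q | Q. Q \<in> orbits (B\<lparr>carrier := A\<rparr>) (conj_classes G)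
           (\<lambda>\<sigma> C. \<Union>x\<in>C. conj_class G (x [^]\<^bsub>G\<^esub> cyclotomic_exponent (Coset.order G) \<sigma>))})
       | A. subgroup A B \<and> A \<subseteq> ring_iso F F})"


subsection \<open>Products\<close>

abbreviation subgrp :: "('a, 'b) monoid_scheme \<Rightarrow> 'a set \<Rightarrow> ('a, 'b) monoid_scheme" where
  "subgrp G N \<equiv> G\<lparr>carrier := N\<rparr>"

definition SupTh_inv :: "('a, 'b) monoid_scheme \<Rightarrow> 'a set \<Rightarrow> 'a sct set" where
  "SupTh_inv G N = {(XX, KK) \<in> SupTh (subgrp G N).
     \<forall>K\<in>KK. \<forall>y\<in>carrier G. (\<lambda>x. y \<otimes>\<^bsub>G\<^esub> x \<otimes>\<^bsub>G\<^esub> inv\<^bsub>G\<^esub> y) ` K = K}"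

definition chars_above ::
    "('a, 'b) monoid_scheme \<Rightarrow> 'a set \<Rightarrow> ('a \<Rightarrow> complex) set \<Rightarrow> ('a \<Rightarrow> complex) set" where
  "chars_above G N Z = {\<theta> \<in> Irr G. \<exists>\<psi>\<in>Z. constituent (subgrp G N) \<psi> (restrict \<theta> N)}"

definition lift_char ::
    "('a, 'b) monoid_scheme \<Rightarrow> 'a set \<Rightarrow> ('a set \<Rightarrow> complex) \<Rightarrow> 'a \<Rightarrow> complex" where
  "lift_char G N \<theta> = (\<lambda>x\<in>carrier G. \<theta> (N #>\<^bsub>G\<^esub> x))"

text \<open>The elements of a superclass \<open>L\<close> of the quotient are cosets, so \<open>\<Union>L\<close> is
  its preimage in \<open>G\<close>.\<close>

definition star_product ::
    "('a, 'b) monoid_scheme \<Rightarrow> 'a set \<Rightarrow> 'a sct \<Rightarrow> 'a set sct \<Rightarrow> 'a sct" where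
  "star_product G N = (\<lambda>(XX, KK) (YY, LL).
     ({chars_above G N Z | Z. Z \<in> XX \<and> Z \<noteq> {principal_char (subgrp G N)}} \<union>
        (\<lambda>Y. lift_char G N ` Y) ` YY,
      KK \<union> {\<Union>L | L. L \<in> LL \<and> L \<noteq> {N}}))"

definition Sup_star_at :: "('a, 'b) monoid_scheme \<Rightarrow> 'a set \<Rightarrow> 'a sct set" where
  "Sup_star_at G N = {star_product G N s t | s t. s \<in> SupTh_inv G N \<and> t \<in> SupTh (G Mod N)}"

definition Sup_star :: "('a, 'b) monoid_scheme \<Rightarrow> 'a sct set" where
  "Sup_star G = (\<Union>N\<in>{N. N \<lhd> G}. Sup_star_at G N)"


subsection \<open>Products over the trivial subgroup\<close>

text \<open>The definition of \<^const>\<open>Sup_star\<close> admits all normal subgroups, and the product over the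
  trivial subgroup returns the theory of \<open>G / 1\<close>. So \<^const>\<open>Sup_star\<close> contains every
  supercharacter theory, and the statement that a theory is not a product has content only for
  products over nontrivial proper normal subgroups.\<close>

lemma trivial_carrier: "group G \<Longrightarrow> carrier (G Mod {\<one>\<^bsub>G\<^esub>}) = (\<lambda>x. {x}) ` carrier G"
  by (auto simp: FactGroup_def RCOSETS_def r_coset_def group.is_monoid monoid.l_one)

lemma rcos_triv: "group G \<Longrightarrow> x \<in> carrier G \<Longrightarrow> {\<one>\<^bsub>G\<^esub>} #>\<^bsub>G\<^esub> x = {x}"
  by (auto simp: r_coset_def group.is_monoid monoid.l_one)

lemma rep_triv:
  assumes "group G"
  shows "matrix_rep (G Mod {\<one>\<^bsub>G\<^esub>}) n \<rho> \<longleftrightarrow> matrix_rep G n (\<lambda>x. \<rho> {x})"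
  unfolding matrix_rep_def trivial_carrier[OF assms]
  by (simp add: FactGroup_def set_mult_def)

lemma irr_triv:
  assumes "group G"
  shows "irreducible_rep (G Mod {\<one>\<^bsub>G\<^esub>}) n \<rho> \<longleftrightarrow> irreducible_rep G n (\<lambda>x. \<rho> {x})"
  unfolding irreducible_rep_def rep_triv[OF assms] invariant_subspace_def trivial_carrier[OF assms]
  by simp

lemma char_triv:
  assumes "group G"
  shows "lift_char G {\<one>\<^bsub>G\<^esub>} (char_of_rep (G Mod {\<one>\<^bsub>G\<^esub>}) \<rho>) = char_of_rep G (\<lambda>x. \<rho> {x})"
  unfolding lift_char_def char_of_rep_def
  by (auto simp: restrict_def rcos_triv[OF assms] trivial_carrier[OF assms])

lemma chars_triv:
  assumes "group G"
  shows "characters G = lift_char G {\<one>\<^bsub>G\<^esub>} ` characters (G Mod {\<one>\<^bsub>G\<^esub>})"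
    and "Irr G = lift_char G {\<one>\<^bsub>G\<^esub>} ` Irr (G Mod {\<one>\<^bsub>G\<^esub>})"
proof -
  have *: "\<exists>\<rho>'. \<rho> = (\<lambda>x. \<rho>' {x})" for \<rho> :: "'a \<Rightarrow> complex mat"
    by (rule exI[of _ "\<lambda>C. \<rho> (the_elem C)"]) simp
  show "characters G = lift_char G {\<one>\<^bsub>G\<^esub>} ` characters (G Mod {\<one>\<^bsub>G\<^esub>})"
  proof (rule equalityI; rule subsetI)
    fix c assume "c \<in> characters G"
    then obtain n \<rho> where "matrix_rep G n \<rho>" "c = char_of_rep G \<rho>" by (auto simp: characters_def)
    moreover obtain \<rho>' where "\<rho> = (\<lambda>x. \<rho>' {x})" using * by blast
    ultimately have "c = lift_char G {\<one>\<^bsub>G\<^esub>} (char_of_rep (G Mod {\<one>\<^bsub>G\<^esub>}) \<rho>')"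
      "matrix_rep (G Mod {\<one>\<^bsub>G\<^esub>}) n \<rho>'"
      using char_triv[OF assms] rep_triv[OF assms] by auto
    then show "c \<in> lift_char G {\<one>\<^bsub>G\<^esub>} ` characters (G Mod {\<one>\<^bsub>G\<^esub>})"
      unfolding characters_def by blast
  next
    fix c assume "c \<in> lift_char G {\<one>\<^bsub>G\<^esub>} ` characters (G Mod {\<one>\<^bsub>G\<^esub>})"
    then show "c \<in> characters G" using char_triv[OF assms] rep_triv[OF assms]
      by (auto simp: characters_def)
  qed
  show "Irr G = lift_char G {\<one>\<^bsub>G\<^esub>} ` Irr (G Mod {\<one>\<^bsub>G\<^esub>})"
  proof (rule equalityI; rule subsetI)
    fix c assume "c \<in> Irr G"
    then obtain n \<rho> where "irreducible_rep G n \<rho>" "c = char_of_rep G \<rho>" by (auto simp: Irr_def)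
    moreover obtain \<rho>' where "\<rho> = (\<lambda>x. \<rho>' {x})" using * by blast
    ultimately have "c = lift_char G {\<one>\<^bsub>G\<^esub>} (char_of_rep (G Mod {\<one>\<^bsub>G\<^esub>}) \<rho>')"
      "irreducible_rep (G Mod {\<one>\<^bsub>G\<^esub>}) n \<rho>'"
      using char_triv[OF assms] irr_triv[OF assms] by auto
    then show "c \<in> lift_char G {\<one>\<^bsub>G\<^esub>} ` Irr (G Mod {\<one>\<^bsub>G\<^esub>})"
      unfolding Irr_def by blast
  next
    fix c assume "c \<in> lift_char G {\<one>\<^bsub>G\<^esub>} ` Irr (G Mod {\<one>\<^bsub>G\<^esub>})"
    then show "c \<in> Irr G" using char_triv[OF assms] irr_triv[OF assms]
      by (auto simp: Irr_def)
  qed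
qed

lemma Irr_one:
  assumes c: "carrier H = {\<one>\<^bsub>H\<^esub>}" and m: "\<one>\<^bsub>H\<^esub> \<otimes>\<^bsub>H\<^esub> \<one>\<^bsub>H\<^esub> = \<one>\<^bsub>H\<^esub>"
  shows "Irr H = {principal_char H}" "principal_char H \<in> characters H"
proof -
  have inv: "W = {0\<^sub>v 1} \<or> W = carrier_vec 1" if W: "invariant_subspace H 1 (\<lambda>x. 1\<^sub>m 1) W" for W
  proof (rule disjCI)
    assume ne: "W \<noteq> carrier_vec 1"
    have sub: "W \<subseteq> carrier_vec 1" and z: "0\<^sub>v 1 \<in> W" and sm: "\<And>c v. v \<in> W \<Longrightarrow> c \<cdot>\<^sub>v v \<in> W"
      using W by (auto simp: invariant_subspace_def)
    { fix w assume w: "w \<in> W" "w \<noteq> 0\<^sub>v 1"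
      then have d: "dim_vec w = 1" using sub by auto
      then have w0: "w $ 0 \<noteq> 0" using w(2) by (auto simp: vec_eq_iff)
      have "v \<in> W" if "v \<in> carrier_vec 1" for v
      proof -
        have "v = (v $ 0 / w $ 0) \<cdot>\<^sub>v w" using that d w0 by (intro eq_vecI) auto
        then show ?thesis using sm[OF w(1)] by metis
      qed
      then have False using ne sub by blast }
    then show "W = {0\<^sub>v 1}" using z by blast
  qed
  have rep: "matrix_rep H 1 (\<lambda>x. 1\<^sub>m 1)" by (simp add: matrix_rep_def)
  have ch: "char_of_rep H (\<lambda>x. 1\<^sub>m 1) = principal_char H"
    by (simp add: char_of_rep_def principal_char_def mat_trace_def)
  show "principal_char H \<in> characters H" unfolding characters_def using rep ch by force
  have p: "principal_char H \<in> Irr H"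
    unfolding Irr_def irreducible_rep_def using inv rep ch by force
  have "\<theta> = principal_char H" if "\<theta> \<in> Irr H" for \<theta>
  proof -
    from that obtain n \<rho> where r: "irreducible_rep H n \<rho>" and t: "\<theta> = char_of_rep H \<rho>"
      by (auto simp: Irr_def)
    from r have n: "n > 0" and one: "\<rho> \<one>\<^bsub>H\<^esub> = 1\<^sub>m n"
      by (auto simp: irreducible_rep_def matrix_rep_def)
    let ?W = "{a \<cdot>\<^sub>v unit_vec n 0 | a. True} :: complex vec set"
    have "invariant_subspace H n \<rho> ?W"
      unfolding invariant_subspace_def c
    proof (intro conjI ballI allI)
      show "?W \<subseteq> carrier_vec n" by auto
      show "0\<^sub>v n \<in> ?W" by (auto intro!: exI[of _ 0] eq_vecI)
      fix v assume v: "v \<in> ?W"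
      fix w assume "w \<in> ?W"
      with v show "v + w \<in> ?W" by (auto simp: add_smult_distrib_vec[symmetric])
    next
      fix a v assume "v \<in> ?W" then show "a \<cdot>\<^sub>v v \<in> ?W" by (auto simp: smult_smult_assoc)
    next
      fix x v assume x: "x \<in> {\<one>\<^bsub>H\<^esub>}" and v: "v \<in> ?W"
      then have "\<rho> x *\<^sub>v v = v" using one by auto
      then show "\<rho> x *\<^sub>v v \<in> ?W" using v by simp
    qed
    then have d: "?W = {0\<^sub>v n} \<or> ?W = carrier_vec n"
      using r by (auto simp: irreducible_rep_def)
    have u: "unit_vec n 0 \<in> ?W" by (auto intro!: exI[of _ 1])
    have "unit_vec n 0 \<noteq> (0\<^sub>v n :: complex vec)" using n
      by (auto simp: vec_eq_iff)
    with u d have W: "?W = carrier_vec n" by (metis singletonD)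
    have "n = 1"
    proof (rule ccontr)
      assume "n \<noteq> 1" with n have n1: "1 < n" by simp
      have "unit_vec n 1 \<in> ?W" unfolding W by simp
      then obtain a where "unit_vec n 1 = a \<cdot>\<^sub>v (unit_vec n 0 :: complex vec)" by auto
      then have "(unit_vec n 1 :: complex vec) $ 1 = (a \<cdot>\<^sub>v unit_vec n 0) $ 1" by simp
      then show False using n1 by simp
    qed
    then show ?thesis unfolding t char_of_rep_def principal_char_def c
      using one by (auto simp: mat_trace_def restrict_def)
  qed
  with p show "Irr H = {principal_char H}" by blast
qed

lemma partition_on_inj_image':
  assumes P: "partition_on A P" and i: "inj_on f A"
  shows "partition_on (f ` A) ((`) f ` P)"
proof (rule partition_onI)
  have sub: "\<And>p. p \<in> P \<Longrightarrow> p \<subseteq> A" using P by (auto simp: partition_on_def)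
  show "\<Union> ((`) f ` P) = f ` A" using P by (auto simp: partition_on_def)
  show "{} \<notin> (`) f ` P" using P by (auto simp: partition_on_def)
  fix p q assume "p \<in> (`) f ` P" "q \<in> (`) f ` P" "p \<noteq> q"
  then obtain a b where ab: "a \<in> P" "b \<in> P" "p = f ` a" "q = f ` b" "a \<noteq> b" by auto
  then have "a \<inter> b = {}" using P by (auto simp: partition_on_def pairwise_def disjnt_def)
  then have "p \<inter> q = {}" using ab sub i inj_on_image_Int[of f A a b] by auto
  then show "disjnt p q" by (simp add: disjnt_def)
qed

theorem SupTh_subset_Sup_star:
  fixes G (structure)
  assumes G: "group G"
  shows "SupTh G \<subseteq> Sup_star G"
proof (rule subrelI)
  interpret group G by fact
  define T where "T = {\<one>}"
  define l where "l = lift_char G T"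
  define p where "p = (\<lambda>\<theta> :: _ \<Rightarrow> complex. \<lambda>C\<in>carrier (G Mod T). \<theta> (the_elem C))"
  define s where "s = (\<lambda>x::'a. {x})"
  note cT = trivial_carrier[OF G, folded T_def]
  note rT = rcos_triv[OF G, folded T_def]
  fix XX KK assume "(XX, KK) \<in> SupTh G"
  then obtain sc where XX: "partition_on (Irr G) XX" and KK: "partition_on (carrier G) KK"
    and one: "{\<one>} \<in> KK" and card: "card XX = card KK"
    and raw: "\<forall>X\<in>XX. sc X \<in> characters G \<and>
        (\<exists>c. \<forall>x\<in>carrier G. sc X x = c * (\<Sum>\<psi>\<in>X. \<psi> \<one> * \<psi> x)) \<and>
        (\<forall>K\<in>KK. \<forall>x\<in>K. \<forall>y\<in>K. sc X x = sc X y)"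
    unfolding SupTh_def mem_Collect_eq case_prod_conv by (elim conjE exE)
  have sc: "\<And>X. X \<in> XX \<Longrightarrow> sc X \<in> characters G"
      "\<And>X. X \<in> XX \<Longrightarrow> \<exists>c. \<forall>x\<in>carrier G. sc X x = c * (\<Sum>\<psi>\<in>X. \<psi> \<one> * \<psi> x)"
      "\<And>X K x y. X \<in> XX \<Longrightarrow> K \<in> KK \<Longrightarrow> x \<in> K \<Longrightarrow> y \<in> K \<Longrightarrow> sc X x = sc X y"
    subgoal for X by (rule raw[THEN bspec, THEN conjunct1])
    subgoal for X by (rule raw[THEN bspec, THEN conjunct2, THEN conjunct1])
    subgoal for X K x y
      by (rule raw[THEN bspec, THEN conjunct2, THEN conjunct2, THEN bspec, THEN bspec, THEN bspec])
    done
  have pl: "p (l \<theta>) = \<theta>" if "\<theta> \<in> extensional (carrier (G Mod T))" for \<theta>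
    using that rT
    by (intro ext) (auto simp: p_def l_def lift_char_def cT restrict_def extensional_def)
  have lp: "l (p \<theta>) = \<theta>" if "\<theta> \<in> extensional (carrier G)" for \<theta>
    using that rT
    by (intro ext) (auto simp: p_def l_def lift_char_def cT restrict_def extensional_def)
  have ext: "characters H \<subseteq> extensional (carrier H)" "Irr H \<subseteq> extensional (carrier H)"
    for H :: "('c,'d) monoid_scheme" by (auto simp: characters_def Irr_def char_of_rep_def)
  have ext': "characters H \<subseteq> extensional (carrier H)" "Irr H \<subseteq> extensional (carrier H)"
    for H :: "('a,'d) monoid_scheme" by (auto simp: characters_def Irr_def char_of_rep_def)
  have ext'': "characters H \<subseteq> extensional (carrier H)" "Irr H \<subseteq> extensional (carrier H)"
    for H :: "'a set monoid" by (auto simp: characters_def Irr_def char_of_rep_def)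
  have extG: "characters G \<subseteq> extensional (carrier G)" "Irr G \<subseteq> extensional (carrier G)"
    by (auto simp: characters_def Irr_def char_of_rep_def)
  note chars = chars_triv[OF G, folded T_def, folded l_def]
  have pch: "p \<theta> \<in> characters (G Mod T)" if "\<theta> \<in> characters G" for \<theta>
    using that pl ext''(1)[of "G Mod T"] unfolding chars(1) by auto
  have pIrr: "p ` Irr G = Irr (G Mod T)"
    unfolding chars(2) image_image
    using image_cong[OF refl, of "Irr (G Mod T)" "\<lambda>x. p (l x)" "\<lambda>x. x"] pl ext''(2)[of "G Mod T"]
    by (metis image_ident subsetD)
  have pinj: "inj_on p (Irr G)"
    by (rule inj_on_inverseI[of _ l]) (use lp extG(2) in blast)
  have XXsub: "\<And>X. X \<in> XX \<Longrightarrow> X \<subseteq> Irr G" using XX by (auto simp: partition_on_def)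
  have KKsub: "\<And>K. K \<in> KK \<Longrightarrow> K \<subseteq> carrier G" using KK by (auto simp: partition_on_def)
  have psing: "p \<theta> {x} = \<theta> x" if "x \<in> carrier G" for \<theta> x
    using that by (simp add: p_def cT)
  have lpX: "l ` p ` X = X" if "X \<in> XX" for X
    unfolding image_image
    using image_cong[OF refl, of X "\<lambda>x. l (p x)" "\<lambda>x. x"] lp XXsub[OF that] extG(2)
    by (metis image_ident subsetD)
  have sinj: "inj s" by (auto simp: s_def inj_def)
  let ?YY = "(`) p ` XX" and ?LL = "(`) s ` KK"
  have quot: "(?YY, ?LL) \<in> SupTh (G Mod T)"
    unfolding SupTh_def
  proof (clarify, intro conjI)
    show "partition_on (Irr (G Mod T)) ?YY"
      using partition_on_inj_image'[OF XX pinj] pIrr by simp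
    show "partition_on (carrier (G Mod T)) ?LL"
      using partition_on_inj_image'[OF KK inj_on_subset[OF sinj]] cT by (simp add: s_def)
    show "{\<one>\<^bsub>G Mod T\<^esub>} \<in> ?LL"
      using one by (force simp: FactGroup_def T_def s_def)
    have "inj_on ((`) p) XX" by (rule inj_on_inverseI[of _ "(`) l"]) (use lpX in blast)
    moreover have "inj_on ((`) s) KK"
      using sinj by (meson inj_image_eq_iff inj_onI)
    ultimately show "card ?YY = card ?LL" using card by (simp add: card_image)
    let ?f = "\<lambda>Y. p (sc (l ` Y))"
    have "?f Y \<in> characters (G Mod T) \<and>
        (\<exists>c. \<forall>x\<in>carrier (G Mod T). ?f Y x = c * (\<Sum>\<psi>\<in>Y. \<psi> \<one>\<^bsub>G Mod T\<^esub> * \<psi> x)) \<and>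
        (\<forall>K\<in>?LL. \<forall>x\<in>K. \<forall>y\<in>K. ?f Y x = ?f Y y)" if "Y \<in> ?YY" for Y
    proof -
      from that obtain X where X: "X \<in> XX" and Y: "Y = p ` X" by blast
      have lY: "l ` Y = X" using lpX[OF X] Y by simp
      obtain c where c: "\<forall>x\<in>carrier G. sc X x = c * (\<Sum>\<psi>\<in>X. \<psi> \<one> * \<psi> x)" using sc(2)[OF X] by blast
      have sm: "(\<Sum>\<psi>\<in>Y. \<psi> T * \<psi> {x}) = (\<Sum>\<psi>\<in>X. \<psi> \<one> * \<psi> x)" if "x \<in> carrier G" for x
        unfolding Y using inj_on_subset[OF pinj XXsub[OF X]] psing[OF that] psing[OF one_closed]
        by (simp add: sum.reindex T_def)
      have "\<forall>x\<in>carrier (G Mod T). ?f Y x = c * (\<Sum>\<psi>\<in>Y. \<psi> \<one>\<^bsub>G Mod T\<^esub> * \<psi> x)"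
        unfolding cT lY using c psing sm by (auto simp: FactGroup_def)
      moreover have "?f Y \<in> characters (G Mod T)" unfolding lY by (rule pch[OF sc(1)[OF X]])
      moreover have "\<forall>K\<in>?LL. \<forall>x\<in>K. \<forall>y\<in>K. ?f Y x = ?f Y y"
      proof (intro ballI)
        fix K a b assume "K \<in> ?LL" "a \<in> K" "b \<in> K"
        then obtain K' x y where "K' \<in> KK" "x \<in> K'" "y \<in> K'" "a = {x}" "b = {y}"
          by (auto simp: s_def)
        then show "?f Y a = ?f Y b" unfolding lY
          using sc(3)[OF X] psing KKsub by (metis subsetD)
      qed
      ultimately show ?thesis by blast
    qed
    then show "\<exists>sc'. \<forall>Y\<in>?YY. sc' Y \<in> characters (G Mod T) \<and>
        (\<exists>c. \<forall>x\<in>carrier (G Mod T). sc' Y x = c * (\<Sum>\<psi>\<in>Y. \<psi> \<one>\<^bsub>G Mod T\<^esub> * \<psi> x)) \<and>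
        (\<forall>K\<in>?LL. \<forall>x\<in>K. \<forall>y\<in>K. sc' Y x = sc' Y y)"
      by (intro exI[of _ ?f] ballI)
  qed
  have I: "Irr (subgrp G T) = {principal_char (subgrp G T)}" "principal_char (subgrp G T) \<in> characters (subgrp G T)"
    by (rule Irr_one; simp add: T_def)+
  have triv: "({{principal_char (subgrp G T)}}, {T}) \<in> SupTh_inv G T"
  proof -
    let ?c = "principal_char (subgrp G T)"
    have "\<forall>x\<in>T. ?c x = 1 * (\<Sum>\<psi>\<in>{?c}. \<psi> \<one> * \<psi> x)" by (simp add: T_def principal_char_def)
    then have "\<exists>c. \<forall>x\<in>T. ?c x = c * (\<Sum>\<psi>\<in>{?c}. \<psi> \<one> * \<psi> x)" by blast
    then have "\<exists>sc. \<forall>X\<in>{{?c}}. sc X \<in> characters (subgrp G T) \<and>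
        (\<exists>c. \<forall>x\<in>T. sc X x = c * (\<Sum>\<psi>\<in>X. \<psi> \<one> * \<psi> x)) \<and>
        (\<forall>K\<in>{T}. \<forall>x\<in>K. \<forall>y\<in>K. sc X x = sc X y)"
      using I(2) by (intro exI[of _ "\<lambda>_. ?c"]) (auto simp: T_def)
    then show ?thesis unfolding SupTh_inv_def SupTh_def
      by (auto simp: I I[unfolded T_def] partition_on_def T_def)
  qed
  have U: "\<Union> (s ` K) = K" for K by (auto simp: s_def)
  have N: "s ` K = {T} \<longleftrightarrow> K = {\<one>}" for K by (auto simp: s_def T_def)
  have "{\<Union>L | L. L \<in> ?LL \<and> L \<noteq> {T}} = {K \<in> KK. K \<noteq> {\<one>}}"
  proof (rule equalityI; rule subsetI)
    fix K assume "K \<in> {\<Union>L | L. L \<in> ?LL \<and> L \<noteq> {T}}"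
    then obtain K' where "K' \<in> KK" "s ` K' \<noteq> {T}" "K = \<Union> (s ` K')" by blast
    then show "K \<in> {K \<in> KK. K \<noteq> {\<one>}}" unfolding U N by simp
  next
    fix K assume "K \<in> {K \<in> KK. K \<noteq> {\<one>}}"
    then have "s ` K \<in> ?LL" "s ` K \<noteq> {T}" unfolding N by simp_all
    then show "K \<in> {\<Union>L | L. L \<in> ?LL \<and> L \<noteq> {T}}" 
      by (intro CollectI exI[of _ "s ` K"] conjI) (rule U[symmetric])
  qed
  moreover have "(\<lambda>Y. l ` Y) ` ?YY = XX"
    unfolding image_image[of "\<lambda>Y. l ` Y" "(`) p"] using image_cong[of XX XX "\<lambda>x. l ` p ` x" "\<lambda>x. x", OF refl lpX] by simp
  moreover have "{chars_above G T Z | Z. Z \<in> {{principal_char (subgrp G T)}} \<and> Z \<noteq> {principal_char (subgrp G T)}} = {}"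
    by blast
  moreover have "{T} \<union> {K \<in> KK. K \<noteq> {\<one>}} = KK" using one unfolding T_def by blast
  ultimately have "star_product G T ({{principal_char (subgrp G T)}}, {T}) (?YY, ?LL) = (XX, KK)"
    unfolding star_product_def l_def[symmetric] case_prod_conv by (simp only: Un_empty_left)
  then have "(XX, KK) \<in> Sup_star_at G T"
    unfolding Sup_star_at_def using quot triv by (metis (mono_tags, lifting) mem_Collect_eq)
  moreover have "T \<lhd> G" unfolding T_def by (rule one_is_normal)
  ultimately show "(XX, KK) \<in> Sup_star G"
    unfolding Sup_star_def by (rule_tac UN_I) simp_all
qed
end

theory Submission
  imports Defs "Jordan_Normal_Form.Spectral_Radius"
begin

text \<open>
  The group \<open>G\<close> is cyclic, generated by \<open>z = (g, h)\<close>. An eigenvector of \<open>\<rho> z\<close> spans an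
  invariant line, so irreducible representations have degree 1 and evaluation at \<open>z\<close> is a
  bijection from the irreducible characters to the roots of unity of order dividing \<open>|G|\<close>. Hence a
  theory with \<open>|G|\<close> superclasses has singleton blocks, and it comes from the trivial action. It is
  not normal because every \<open>N\<^sup>\<circ>\<close> is closed under inversion whereas \<open>z\<close> is not an involution.

  The superclass of \<open>(1, h)\<close> contains \<open>(1, h\<^sup>2)\<close>, but in a theory from automorphisms (of
  \<open>G\<close>, or of the cyclotomic field, where the exponents are coprime to \<open>|G|\<close>) all elements of a
  superclass have the same order. In a product over \<open>N\<close>, the subgroup \<open>N\<close> is a union
  of superclasses and each of the remaining superclasses is a union of cosets of \<open>N\<close>; for the four
  superclasses of \<open>A \<times> B\<close> this forces \<open>N\<close> to be trivial or everything.
\<close>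

section \<open>Irreducible characters of finite cyclic groups\<close>

text \<open>In a finite group inverses are themselves natural powers, so natural exponents already
  reach every element of \<open>generate G {z}\<close>.\<close>

lemma (in group) cyclic_elems:
  assumes "z \<in> carrier G" "carrier G = generate G {z}" "finite (carrier G)" "x \<in> carrier G"
  obtains k :: nat where "x = z [^] k"
proof -
  have "x \<in> {z [^] k | k. k \<in> (UNIV :: nat set)}"
    using assms(4) unfolding assms(2) generate_pow_on_finite_carrier[OF assms(3,1)] .
  then show ?thesis using that by blast
qed

lemma invariant_subspace_line:
  assumes v: "v \<in> carrier_vec n" and \<rho>: "\<forall>x\<in>carrier G. \<rho> x \<in> carrier_mat n n"
    and ev: "\<And>x. x \<in> carrier G \<Longrightarrow> \<exists>k. \<rho> x *\<^sub>v v = k \<cdot>\<^sub>v v"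
  shows "invariant_subspace G n \<rho> {a \<cdot>\<^sub>v v | a. True}"
  unfolding invariant_subspace_def
proof (intro conjI ballI allI)
  let ?W = "{a \<cdot>\<^sub>v v | a. True}"
  show "?W \<subseteq> carrier_vec n" using v by auto
  show "0\<^sub>v n \<in> ?W" using v by (auto intro!: exI[of _ 0] eq_vecI)
  fix w assume w: "w \<in> ?W"
  { fix u assume "u \<in> ?W" then show "w + u \<in> ?W"
      using w by (auto simp: add_smult_distrib_vec[symmetric]) }
  { fix a show "a \<cdot>\<^sub>v w \<in> ?W" using w by (auto simp: smult_smult_assoc) }
  { fix x assume x: "x \<in> carrier G"
    obtain k where k: "\<rho> x *\<^sub>v v = k \<cdot>\<^sub>v v" using ev[OF x] by blast
    obtain a where a: "w = a \<cdot>\<^sub>v v" using w by blast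
    have "\<rho> x *\<^sub>v w = a \<cdot>\<^sub>v (\<rho> x *\<^sub>v v)"
      unfolding a using bspec[OF \<rho> x] v by (rule mult_mat_vec)
    then show "\<rho> x *\<^sub>v w \<in> ?W" by (auto simp: k smult_smult_assoc) }
qed

text \<open>For larger \<open>n\<close> two unit vectors would be multiples of \<open>v\<close>: the
  first makes \<open>v $ 0\<close> nonzero, so the second has factor \<open>b = 0\<close> and loses
  its entry 1.\<close>

lemma line_eq_carrier_vec_imp_dim:
  fixes v :: "'a :: field vec"
  assumes "n > 0" "{a \<cdot>\<^sub>v v | a. True} = carrier_vec n"
  shows "n = 1"
proof (rule ccontr)
  assume "n \<noteq> 1" with assms have n: "1 < n" by simp
  have "unit_vec n 0 \<in> {a \<cdot>\<^sub>v v | a. True}" "unit_vec n 1 \<in> {a \<cdot>\<^sub>v v | a. True}"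
    unfolding assms(2) by simp_all
  then obtain a b where a: "unit_vec n 0 = a \<cdot>\<^sub>v v" and b: "unit_vec n 1 = b \<cdot>\<^sub>v v" by auto
  have d: "dim_vec v = n" using arg_cong[OF a, of dim_vec] by simp
  have "a * v $ 0 = 1" "b * v $ 0 = 0" "b * v $ 1 = 1"
    using arg_cong[OF a, of "\<lambda>u. u $ 0"] arg_cong[OF b, of "\<lambda>u. u $ 0"]
      arg_cong[OF b, of "\<lambda>u. u $ 1"] n d by simp_all
  then show False by auto
qed

lemma (in group) cyclic_irreducible_rep_degree:
  assumes z: "z \<in> carrier G" "carrier G = generate G {z}" "finite (carrier G)"
    and \<rho>: "irreducible_rep G n \<rho>"
  shows "n = 1"
proof -
  have n: "n > 0" and car: "\<forall>x\<in>carrier G. \<rho> x \<in> carrier_mat n n" and one: "\<rho> \<one> = 1\<^sub>m n"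
    and mult: "\<And>x y. \<lbrakk>x \<in> carrier G; y \<in> carrier G\<rbrakk> \<Longrightarrow> \<rho> (x \<otimes> y) = \<rho> x * \<rho> y"
    using \<rho> by (auto simp: irreducible_rep_def matrix_rep_def)
  have \<rho>z: "\<rho> z \<in> carrier_mat n n" using car z by blast
  \<comment> \<open>A complex matrix of positive size has an eigenvalue; an eigenvector for the
    generator is one for every power, hence for the whole group.\<close>
  obtain k where "eigenvalue (\<rho> z) k"
    using spectrum_non_empty[OF \<rho>z n] by (auto simp: spectrum_def)
  then obtain v where v: "v \<in> carrier_vec n" "v \<noteq> 0\<^sub>v n" "\<rho> z *\<^sub>v v = k \<cdot>\<^sub>v v"
    using \<rho>z by (auto simp: eigenvalue_def eigenvector_def)
  have pow: "\<rho> (z [^] j) *\<^sub>v v = k ^ j \<cdot>\<^sub>v v" for j :: nat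
  proof (induction j)
    case 0 then show ?case using one v(1) by simp
  next
    case (Suc j)
    have zj: "\<rho> (z [^] j) \<in> carrier_mat n n" using car z(1) by blast
    have "\<rho> (z [^] Suc j) *\<^sub>v v = \<rho> (z [^] j) *\<^sub>v (\<rho> z *\<^sub>v v)"
      using zj \<rho>z v(1) z(1) by (simp add: mult)
    also have "\<dots> = k \<cdot>\<^sub>v (\<rho> (z [^] j) *\<^sub>v v)"
      unfolding v(3) using zj v(1) by (rule mult_mat_vec)
    finally show ?case by (simp add: Suc.IH smult_smult_assoc)
  qed
  let ?W = "{a \<cdot>\<^sub>v v | a. True}"
  have "invariant_subspace G n \<rho> ?W"
  proof (rule invariant_subspace_line[OF v(1) car])
    fix x assume "x \<in> carrier G"
    then obtain j :: nat where "x = z [^] j" using cyclic_elems[OF z] by blast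
    then show "\<exists>k. \<rho> x *\<^sub>v v = k \<cdot>\<^sub>v v" using pow by blast
  qed
  then have "?W = {0\<^sub>v n} \<or> ?W = carrier_vec n" using \<rho> by (auto simp: irreducible_rep_def)
  moreover have "v \<in> ?W" by (auto intro!: exI[of _ 1])
  ultimately have "?W = carrier_vec n" using v(2) by blast
  with n show ?thesis by (rule line_eq_carrier_vec_imp_dim)
qed

lemma matrix_rep_degree_1_irreducible:
  assumes "matrix_rep G 1 \<rho>"
  shows "irreducible_rep G 1 \<rho>"
  unfolding irreducible_rep_def
proof (intro conjI allI impI assms disjCI)
  fix W assume W: "invariant_subspace G 1 \<rho> W" and ne: "W \<noteq> carrier_vec 1"
  have sub: "W \<subseteq> carrier_vec 1" and z: "0\<^sub>v 1 \<in> W" and sm: "\<And>c v. v \<in> W \<Longrightarrow> c \<cdot>\<^sub>v v \<in> W"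
    using W by (auto simp: invariant_subspace_def)
  have "w = 0\<^sub>v 1" if w: "w \<in> W" for w
  proof (rule ccontr)
    assume "w \<noteq> 0\<^sub>v 1"
    with w sub have d: "dim_vec w = 1" and w0: "w $ 0 \<noteq> 0" by (auto simp: vec_eq_iff)
    have "v \<in> W" if "v \<in> carrier_vec 1" for v
    proof -
      have "v = (v $ 0 / w $ 0) \<cdot>\<^sub>v w" using that d w0 by (intro eq_vecI) auto
      then show ?thesis using sm[OF w] by metis
    qed
    then show False using ne sub by blast
  qed
  then show "W = {0\<^sub>v 1}" using z by blast
qed

text \<open>In degree 1 the trace is the only entry of the matrix, so the multiplicativity of the
  representation passes to the character.\<close>

lemma (in group) Irr_cyclic_hom:
  assumes z: "z \<in> carrier G" "carrier G = generate G {z}" "finite (carrier G)"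
    and \<psi>: "\<psi> \<in> Irr G"
  shows "\<psi> \<one> = 1" "\<lbrakk>x \<in> carrier G; y \<in> carrier G\<rbrakk> \<Longrightarrow> \<psi> (x \<otimes> y) = \<psi> x * \<psi> y"
proof -
  obtain n \<rho> where \<rho>: "irreducible_rep G n \<rho>" and ch: "\<psi> = char_of_rep G \<rho>"
    using \<psi> by (auto simp: Irr_def)
  have n: "n = 1" using cyclic_irreducible_rep_degree[OF z \<rho>] .
  have \<rho>1: "\<rho> \<one> = 1\<^sub>m 1" and car: "\<And>x. x \<in> carrier G \<Longrightarrow> \<rho> x \<in> carrier_mat 1 1"
    and mult: "\<And>x y. \<lbrakk>x \<in> carrier G; y \<in> carrier G\<rbrakk> \<Longrightarrow> \<rho> (x \<otimes> y) = \<rho> x * \<rho> y"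
    using \<rho> by (auto simp: irreducible_rep_def matrix_rep_def n)
  have val: "\<psi> x = \<rho> x $$ (0, 0)" if "x \<in> carrier G" for x
    using car[OF that] that by (simp add: ch char_of_rep_def mat_trace_def)
  show "\<psi> \<one> = 1" by (simp add: val \<rho>1)
  assume xy: "x \<in> carrier G" "y \<in> carrier G"
  show "\<psi> (x \<otimes> y) = \<psi> x * \<psi> y"
    using car[OF xy(1)] car[OF xy(2)] xy by (simp add: val mult scalar_prod_def)
qed

lemma (in group) Irr_cyclic_pow:
  assumes z: "z \<in> carrier G" "carrier G = generate G {z}" "finite (carrier G)"
    and \<psi>: "\<psi> \<in> Irr G" and x: "x \<in> carrier G"
  shows "\<psi> (x [^] (k :: nat)) = \<psi> x ^ k"
  by (induction k) (simp_all add: Irr_cyclic_hom[OF z \<psi>] x)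

text \<open>Makes the assignment of \<open>w ^ k\<close> to \<open>z [^] k\<close> well defined,
  which is what turns a root of unity into a representation. Exponents of the same element differ by
  a multiple of \<open>ord z\<close>.\<close>

lemma (in group) power_eq_of_pow_eq:
  fixes w :: "'c :: monoid_mult"
  assumes z: "z \<in> carrier G" and w: "w ^ ord z = 1" and eq: "z [^] (i :: nat) = z [^] j"
  shows "w ^ i = w ^ j"
  using eq
proof (induction i j rule: linorder_wlog)
  case (le i j)
  have "z [^] i \<otimes> z [^] (j - i) = z [^] j" using le(1) z by (simp add: nat_pow_mult)
  then have "z [^] (j - i) = \<one>" using le(2) z by (simp add: l_cancel_one')
  then obtain m where "j - i = ord z * m" using pow_eq_id[OF z] by auto
  then have "w ^ j = w ^ i * (w ^ ord z) ^ m"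
    using le by (metis le_add_diff_inverse power_add power_mult)
  then show ?case using w by simp
qed simp

text \<open>Injectivity: a multiplicative function is fixed by its value at a generator, and
  characters are extensional. Surjectivity: a root \<open>w\<close> gives the degree 1
  representation sending \<open>z [^] k\<close> to \<open>w ^ k\<close>.\<close>

lemma (in group) bij_betw_Irr_cyclic:
  assumes z: "z \<in> carrier G" "carrier G = generate G {z}" "finite (carrier G)"
  shows "bij_betw (\<lambda>\<psi>. \<psi> z) (Irr G) {w. w ^ Coset.order G = 1}"
proof (rule bij_betwI')
  have ext: "\<psi> \<in> extensional (carrier G)" if "\<psi> \<in> Irr G" for \<psi>
    using that by (auto simp: Irr_def char_of_rep_def)
  fix \<psi> \<psi>' assume \<psi>: "\<psi> \<in> Irr G" "\<psi>' \<in> Irr G"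
  show "\<psi> z = \<psi>' z \<longleftrightarrow> \<psi> = \<psi>'"
  proof
    assume eq: "\<psi> z = \<psi>' z"
    show "\<psi> = \<psi>'"
    proof (rule extensionalityI[OF ext ext])
      fix x assume "x \<in> carrier G"
      then obtain k :: nat where "x = z [^] k" using cyclic_elems[OF z] by blast
      then show "\<psi> x = \<psi>' x" 
        using Irr_cyclic_pow[OF z \<psi>(1) z(1), of k] Irr_cyclic_pow[OF z \<psi>(2) z(1), of k] eq
        by simp
    qed (fact \<psi>)+
  qed simp
next
  fix \<psi> assume \<psi>: "\<psi> \<in> Irr G"
  show "\<psi> z \<in> {w. w ^ Coset.order G = 1}"
    using Irr_cyclic_pow[OF z \<psi> z(1), of "Coset.order G"] Irr_cyclic_hom(1)[OF z \<psi>] z(1)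
    by (simp add: pow_order_eq_1)
next
  fix w :: complex assume w: "w \<in> {w. w ^ Coset.order G = 1}"
  have ord: "ord z = Coset.order G" using generate_pow_card[OF z(1)] z(2) by (simp add: Coset.order_def)
  \<comment> \<open>\<open>e x\<close> is an arbitrary exponent of \<open>x\<close>; the fact
    \<open>we\<close> shows that the choice does not affect \<open>w ^ e x\<close>.\<close>
  define e where "e x = (SOME k :: nat. x = z [^] k)" for x
  have e: "z [^] e x = x" if "x \<in> carrier G" for x
    unfolding e_def using cyclic_elems[OF z that] by (metis (mono_tags, lifting) someI)
  have we: "w ^ e (z [^] k) = w ^ k" for k :: nat
    using w e z(1) ord by (intro power_eq_of_pow_eq[OF z(1)]) auto
  define \<rho> where "\<rho> x = mat 1 1 (\<lambda>_. w ^ e x)" for x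
  have "w ^ e (x \<otimes> y) = w ^ e x * w ^ e y" if "x \<in> carrier G" "y \<in> carrier G" for x y
    using we[of "e x + e y"] e that z(1) by (simp add: power_add nat_pow_mult[symmetric])
  moreover have "w ^ e \<one> = 1" using we[of 0] by simp
  ultimately have "matrix_rep G 1 \<rho>"
    by (auto simp: matrix_rep_def \<rho>_def scalar_prod_def intro!: eq_matI)
  then have "char_of_rep G \<rho> \<in> Irr G"
    unfolding Irr_def using matrix_rep_degree_1_irreducible by blast
  moreover have "w = char_of_rep G \<rho> z"
    using we[of 1] z(1) by (simp add: char_of_rep_def mat_trace_def \<rho>_def)
  ultimately show "\<exists>\<psi>\<in>Irr G. w = \<psi> z" by blast
qed

lemma (in group) card_Irr_cyclic:
  assumes z: "z \<in> carrier G" "carrier G = generate G {z}" "finite (carrier G)"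
  shows "finite (Irr G)" "card (Irr G) = Coset.order G"
proof -
  have o: "Coset.order G > 0" using z(3) by (simp add: order_gt_0_iff_finite)
  then show "card (Irr G) = Coset.order G"
    using bij_betw_same_card[OF bij_betw_Irr_cyclic[OF z]] card_roots_unity_eq by simp
  \<comment> \<open>An infinite set has \<open>card\<close> 0, so the positive cardinality already
    gives finiteness.\<close>
  with o show "finite (Irr G)" by (metis card.infinite less_nat_zero_code)
qed

section \<open>The theory of conjugacy classes\<close>

lemma (in comm_group) conj_class_comm:
  assumes "x \<in> carrier G" shows "conj_class G x = {x}"
proof -
  have "y \<otimes> x \<otimes> inv y = x" if "y \<in> carrier G" for y
    using assms that by (simp add: m_comm[of y x] m_assoc)
  then show ?thesis using assms by (auto simp: conj_class_def intro!: exI[of _ \<one>])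
qed

lemma (in comm_group) conj_classes_comm: "conj_classes G = (\<lambda>x. {x}) ` carrier G"
  unfolding conj_classes_def using conj_class_comm by (intro image_cong) auto

text \<open>Choosing one point per block is injective, and the equal counts make it surjective; a
  second point of a block would be the chosen point of another block.\<close>

lemma partition_on_card_eq_imp_singletons:
  assumes A: "finite A" and P: "partition_on A P" and card: "card P = card A"
  shows "P = (\<lambda>x. {x}) ` A"
proof -
  obtain f where f: "\<And>p. p \<in> P \<Longrightarrow> f p \<in> p"
    using partition_onD3[OF P] by (metis ex_in_conv)
  have sub: "\<And>p. p \<in> P \<Longrightarrow> p \<subseteq> A" using partition_onD1[OF P] by blast
  have uniq: "p = q" if "p \<in> P" "q \<in> P" "x \<in> p" "x \<in> q" for p q x
    using partition_onD2[OF P] that by (auto simp: disjoint_def)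
  have "inj_on f P" using f uniq by (metis inj_onI)
  then have "f ` P = A"
    using card_subset_eq[OF A, of "f ` P"] f sub card by (auto simp: card_image)
  moreover have "p = {f p}" if "p \<in> P" for p
  proof -
    have "x = f p" if "x \<in> p" for x
    proof -
      have "x \<in> f ` P" unfolding \<open>f ` P = A\<close> using sub[OF \<open>p \<in> P\<close>] that by blast
      then obtain q where q: "q \<in> P" "x = f q" by blast
      then have "q = p" using uniq[OF q(1) \<open>p \<in> P\<close>] f that by blast
      then show ?thesis using q by simp
    qed
    then show ?thesis using f[OF that] by blast
  qed
  then have "(\<lambda>p. {f p}) ` P = (\<lambda>p. p) ` P" by (intro image_cong) auto
  ultimately show ?thesis by (simp add: image_image[symmetric, of "\<lambda>x. {x}" f])
qed

lemma partition_on_singletons: "partition_on A ((\<lambda>x. {x}) ` A)"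
  by (rule partition_onI) (auto simp: disjnt_def)

text \<open>Commutativity makes the classes singletons, and cyclicity gives equally many irreducible
  characters, so \<open>card XX = card KK\<close> leaves only singleton blocks. The equivalence
  yields existence and uniqueness at once.\<close>

lemma (in comm_group) SupTh_conj_classes_cyclic:
  assumes z: "z \<in> carrier G" "carrier G = generate G {z}" "finite (carrier G)"
  shows "T \<in> SupTh G \<and> snd T = conj_classes G \<longleftrightarrow>
    T = ((\<lambda>\<psi>. {\<psi>}) ` Irr G, conj_classes G)"
proof
  have inj: "inj_on (\<lambda>x. {x}) X" for X :: "'c set" by (simp add: inj_on_def)
  have card: "card (Irr G) = card (conj_classes G)"
    unfolding conj_classes_comm card_image[OF inj] card_Irr_cyclic(2)[OF z]
    by (rule Coset.order_def)
  {
    assume "T \<in> SupTh G \<and> snd T = conj_classes G"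
    then obtain XX where T: "T = (XX, conj_classes G)"
      and "partition_on (Irr G) XX" "card XX = card (conj_classes G)"
      unfolding SupTh_def by auto
    then have "XX = (\<lambda>\<psi>. {\<psi>}) ` Irr G"
      using card card_Irr_cyclic(1)[OF z] by (intro partition_on_card_eq_imp_singletons) auto
    then show "T = ((\<lambda>\<psi>. {\<psi>}) ` Irr G, conj_classes G)" using T by simp
  next
    assume T: "T = ((\<lambda>\<psi>. {\<psi>}) ` Irr G, conj_classes G)"
    have "Irr G \<subseteq> characters G"
      by (auto simp: Irr_def characters_def irreducible_rep_def)
    moreover have "\<exists>c. \<forall>x\<in>carrier G. \<psi> x = c * (\<Sum>\<psi>\<in>{\<psi>}. \<psi> \<one> * \<psi> x)" if "\<psi> \<in> Irr G" for \<psi>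
      using Irr_cyclic_hom(1)[OF z that] by (intro exI[of _ 1]) simp
    moreover have "\<forall>x\<in>K. \<forall>y\<in>K. \<psi> x = \<psi> y" if "K \<in> conj_classes G" for K and \<psi> :: "'a \<Rightarrow> complex"
      using that unfolding conj_classes_comm by auto
    ultimately have "\<exists>sc. \<forall>X\<in>(\<lambda>\<psi>. {\<psi>}) ` Irr G. sc X \<in> characters G \<and>
        (\<exists>c. \<forall>x\<in>carrier G. sc X x = c * (\<Sum>\<psi>\<in>X. \<psi> \<one> * \<psi> x)) \<and>
        (\<forall>K\<in>conj_classes G. \<forall>x\<in>K. \<forall>y\<in>K. sc X x = sc X y)"
      \<comment> \<open>The supercharacter of the block \<open>{\<psi>}\<close> is
        \<open>\<psi>\<close> itself; the multiple is 1 because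
        \<open>\<psi> \<one> = 1\<close>.\<close>
      by (intro exI[of _ the_elem]) auto
    moreover have "{\<one>} \<in> conj_classes G" unfolding conj_classes_comm by blast
    moreover have "partition_on (carrier G) (conj_classes G)"
      unfolding conj_classes_comm by (rule partition_on_singletons)
    ultimately show "T \<in> SupTh G \<and> snd T = conj_classes G"
      unfolding T SupTh_def using card by (simp add: partition_on_singletons card_image[OF inj])
  }
qed

lemma (in group) singletons_conj_classes_AutSup:
  "((\<lambda>\<psi>. {\<psi>}) ` Irr G, conj_classes G) \<in> AutSup G"
proof -
  \<comment> \<open>The trivial action suffices: the one element of \<open>E\<close> goes to the
    identity map, restricted to the carrier because elements of \<open>AutoGroup G\<close> are
    extensional.\<close>
  define E :: "nat monoid" where "E = \<lparr>carrier = {0}, monoid.mult = \<lambda>_ _. 0, one = 0\<rparr>"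
  define \<phi> where "\<phi> = (\<lambda>_::nat. \<lambda>x\<in>carrier G. x)"
  have E: "group E" unfolding E_def by (rule groupI) auto
  have car: "carrier E = {0}" by (simp add: E_def)
  have orb: "orbits E X f = (\<lambda>x. {f 0 x}) ` X" for X :: "'c set" and f
    by (auto simp: orbits_def orbit_def car)
  have "\<phi> \<in> hom E (AutoGroup G)"
    using id_in_auto id_Bij[of "carrier G"]
    by (auto simp: \<phi>_def hom_def car AutoGroup_def BijGroup_def compose_def restrict_def)
  moreover have "orbits E (Irr G) (\<lambda>a \<theta>. \<lambda>x\<in>carrier G. \<theta> (\<phi> (inv\<^bsub>E\<^esub> a) x)) = (\<lambda>\<psi>. {\<psi>}) ` Irr G"
  proof -
    have "(\<lambda>x\<in>carrier G. \<psi> (\<phi> (inv\<^bsub>E\<^esub> 0) x)) = \<psi>" if "\<psi> \<in> Irr G" for \<psi>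
      using that by (auto simp: Irr_def char_of_rep_def \<phi>_def)
    then show ?thesis unfolding orb by (intro image_cong) auto
  qed
  moreover have "{\<Union>Q | Q. Q \<in> orbits E (conj_classes G) (\<lambda>a C. \<phi> a ` C)} = conj_classes G"
  proof -
    have "\<phi> 0 ` C = C" if "C \<in> conj_classes G" for C
      using that by (force simp: conj_classes_def conj_class_def \<phi>_def)
    then have "orbits E (conj_classes G) (\<lambda>a C. \<phi> a ` C) = (\<lambda>C. {C}) ` conj_classes G"
      unfolding orb by (intro image_cong) auto
    then show ?thesis by auto
  qed
  ultimately show ?thesis
    unfolding AutSup_def using E car by (auto intro!: exI[of _ E] exI[of _ \<phi>])
qed

lemma (in comm_group) subgroup_normal_closure_system:
  assumes S: "S \<subseteq> {N. N \<lhd> G}" and N: "N \<in> normal_closure_system G S"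
  shows "subgroup N G"
  using N
proof induction
  case (base N) then show ?case using S normal_imp_subgroup by blast
next
  case (prod N H) then show ?case by (simp add: mult_subgroups)
next
  case (inter N H) then show ?case by (simp add: subgroups_Inter_pair)
qed (simp_all add: subgroup_self triv_subgroup)

text \<open>Every set in \<open>normal_closure_system G S\<close> is a subgroup, so inversion never
  changes membership in any of the sets from which \<open>normal_circ\<close> is formed.\<close>

lemma (in comm_group) normal_circ_inv:
  assumes S: "S \<subseteq> {N. N \<lhd> G}" and N: "N \<in> normal_closure_system G S"
    and x: "x \<in> normal_circ G S N"
  shows "inv x \<in> normal_circ G S N"
proof -
  have sub: "\<And>H. H \<in> normal_closure_system G S \<Longrightarrow> subgroup H G"
    by (rule subgroup_normal_closure_system[OF S])
  have "x \<in> carrier G" using x subgroup.subset[OF sub[OF N]] by (auto simp: normal_circ_def)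
  then have "inv x \<in> H \<longleftrightarrow> x \<in> H" if "H \<in> normal_closure_system G S" for H
    using subgroup.m_inv_closed[OF sub[OF that]] by (metis inv_inv)
  then show ?thesis using x N by (auto simp: normal_circ_def)
qed

lemma (in comm_group) NSup_superclasses_ne_conj_classes:
  assumes x: "x \<in> carrier G" "inv x \<noteq> x" and T: "T \<in> NSup G"
  shows "snd T \<noteq> conj_classes G"
proof
  assume "snd T = conj_classes G"
  then have "{x} \<in> snd T" using x(1) by (simp add: conj_classes_comm)
  moreover obtain S where S: "S \<subseteq> {N. N \<lhd> G}" and "T = normal_sct G S"
    using T by (auto simp: NSup_def)
  ultimately obtain N where N: "N \<in> normal_closure_system G S" "normal_circ G S N = {x}"
    by (auto simp: normal_sct_def)
  then show False using normal_circ_inv[OF S N(1), of x] x(2) by simp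
qed

section \<open>Superclasses of theories from automorphisms and of products\<close>

text \<open>A superclass consists of the images of a single element \<open>c\<close> under
  automorphisms. Injectivity carries the relation from \<open>x\<close> back to \<open>c\<close>,
  and the homomorphism property carries it on to \<open>y\<close>.\<close>

lemma (in comm_group) AutSup_superclass_pow:
  assumes T: "T \<in> AutSup G" and K: "K \<in> snd T" "x \<in> K" "y \<in> K"
    and n: "x [^] (n :: nat) = \<one>"
  shows "y [^] n = \<one>"
proof -
  obtain A :: "nat monoid" and \<phi> where \<phi>: "\<phi> \<in> hom A (AutoGroup G)"
    and "K \<in> {\<Union>Q | Q. Q \<in> orbits A (conj_classes G) (\<lambda>a C. \<phi> a ` C)}"
    using T K(1) unfolding AutSup_def by auto
  then obtain c where c: "c \<in> carrier G" and "K = \<Union> (orbit A (\<lambda>a C. \<phi> a ` C) {c})"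
    by (auto simp: orbits_def conj_classes_comm)
  then have Kc: "K = {\<phi> a c | a. a \<in> carrier A}" by (auto simp: orbit_def)
  have aut: "\<phi> a \<in> hom G G" "inj_on (\<phi> a) (carrier G)" if "a \<in> carrier A" for a
    using hom_in_carrier[OF \<phi> that] by (auto simp: AutoGroup_def auto_def Bij_def bij_betw_def)
  have pow: "\<phi> a c [^] n = \<phi> a (c [^] n)" "\<phi> a \<one> = \<one>" if "a \<in> carrier A" for a
    using group_hom.hom_nat_pow[of G G "\<phi> a" c n] group_hom.hom_one[of G G "\<phi> a"] aut(1)[OF that] c
    by (simp_all add: group_hom_def group_hom_axioms_def)
  obtain a b where a: "a \<in> carrier A" "x = \<phi> a c" and b: "b \<in> carrier A" "y = \<phi> b c"
    using K Kc by auto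
  have "\<phi> a (c [^] n) = \<phi> a \<one>" using pow[OF a(1)] n a(2) by simp
  then have "c [^] n = \<one>" using inj_onD[OF aut(2)[OF a(1)]] c by simp
  then show ?thesis using pow[OF b(1)] b(2) by simp
qed

lemma root_of_unity_pow: "root_of_unity n ^ k = cis (2 * pi * real k / real n)"
  by (simp add: root_of_unity_def DeMoivre mult_ac)

text \<open>With \<open>d = gcd e n\<close>, the root raised to \<open>n div d\<close> is sent to an
  \<open>n\<close>-th power of a root, that is to 1, the image of 1. Injectivity of
  \<open>\<sigma>\<close> makes it 1 already, which forces \<open>d = 1\<close>.\<close>

lemma cyclotomic_exponent_coprime:
  assumes n: "n > 0" and \<sigma>: "\<sigma> \<in> ring_iso (cyclotomic_field n) (cyclotomic_field n)"
  shows "coprime (cyclotomic_exponent n \<sigma>) n"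
proof -
  let ?z = "root_of_unity n" and ?F = "cyclotomic_field n"
  define e where "e = cyclotomic_exponent n \<sigma>"
  have hom: "\<sigma> \<in> Ring.ring_hom ?F ?F" and inj: "inj_on \<sigma> (carrier ?F)"
    using \<sigma> by (auto simp: ring_iso_def bij_betw_def)
  have mem: "?z ^ k \<in> carrier ?F" for k
  proof -
    have *: "?z ^ k = poly (map_poly of_rat (monom (1 :: rat) k)) ?z"
      by (simp add: map_poly_monom poly_monom)
    show ?thesis unfolding cyclotomic_field_def
      by simp (rule exI, rule *)
  qed
  have bij: "bij_betw (\<lambda>k. ?z ^ k) {..<n} {w. w ^ n = 1}"
    using bij_betw_roots_unity[OF n] by (simp add: root_of_unity_pow)
  have zn: "?z ^ n = 1" using n by (simp add: root_of_unity_pow)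
  have \<sigma>1: "\<sigma> 1 = 1" using ring_hom_one[OF hom] by (simp add: cyclotomic_field_def)
  have \<sigma>pow: "\<sigma> (?z ^ k) = \<sigma> ?z ^ k" for k
  proof (induction k)
    case (Suc k)
    then show ?case
      using ring_hom_mult[OF hom mem[of 1] mem[of k]] by (simp add: cyclotomic_field_def)
  qed (simp add: \<sigma>1)
  \<comment> \<open>\<open>LEAST\<close> is meaningful only if some exponent exists:
    \<open>\<sigma> ?z\<close> is again an \<open>n\<close>-th root of unity, hence a power of
    \<open>?z\<close>.\<close>
  have "\<sigma> ?z \<in> {w. w ^ n = 1}" using \<sigma>pow[of n] zn \<sigma>1 by simp
  then obtain r where "\<sigma> ?z = ?z ^ r" using bij by (auto simp: bij_betw_def)
  then have \<sigma>z: "\<sigma> ?z = ?z ^ e" unfolding e_def cyclotomic_exponent_def by (rule LeastI)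
  define d where "d = gcd e n"
  have d: "d > 0" "d dvd e" "d dvd n" using n by (auto simp: d_def)
  have "e * (n div d) = n * (e div d)" using d
    by (metis div_mult_swap mult.commute)
  then have "\<sigma> (?z ^ (n div d)) = (?z ^ n) ^ (e div d)"
    unfolding \<sigma>pow \<sigma>z by (metis power_mult)
  then have "\<sigma> (?z ^ (n div d)) = \<sigma> (?z ^ 0)" by (simp add: zn \<sigma>1)
  then have *: "?z ^ (n div d) = ?z ^ 0" using inj_onD[OF inj _ mem mem] by blast
  have "d = 1"
  proof (rule ccontr)
    assume "d \<noteq> 1"
    \<comment> \<open>For \<open>d > 1\<close> the exponent \<open>n div d\<close> falls below
      \<open>n\<close>, within the range where powers of \<open>?z\<close> are distinct.\<close>
    then have "n div d \<in> {..<n}" "0 \<in> {..<n}" using d(1) n by auto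
    with * bij have "n div d = 0" by (metis bij_betw_imp_inj_on inj_onD)
    then show False using d n by (auto elim: dvdE)
  qed
  then show ?thesis unfolding d_def e_def by (simp add: coprime_iff_gcd_eq_1)
qed

text \<open>Since \<open>ord c\<close> divides the group order, \<open>e\<close> is coprime to
  \<open>ord c\<close> and cancels from \<open>ord c dvd e * k\<close>.\<close>

lemma (in group) pow_coprime_eq_one:
  assumes c: "c \<in> carrier G" and e: "coprime e (Coset.order G)" and eq: "c [^] (e * k) = \<one>"
  shows "c [^] (k :: nat) = \<one>"
proof -
  have "coprime (ord c) e"
    using coprime_divisors[OF dvd_refl ord_dvd_group_order[OF c] e] by (simp add: coprime_commute)
  moreover have "ord c dvd e * k" using eq c by (simp add: pow_eq_id)
  ultimately show ?thesis using c by (simp add: pow_eq_id coprime_dvd_mult_right_iff)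
qed

text \<open>The elements of a superclass are powers of a single \<open>c\<close> with exponents from
  field automorphisms. Coprimality cancels the exponent of \<open>x\<close>, giving
  \<open>c [^] n = \<one>\<close>, and this passes to the power \<open>y\<close>.\<close>

lemma (in comm_group) ACSup_superclass_pow:
  assumes fin: "finite (carrier G)"
    and T: "T \<in> ACSup G" and K: "K \<in> snd T" "x \<in> K" "y \<in> K"
    and n: "x [^] (n :: nat) = \<one>"
  shows "y [^] n = \<one>"
proof -
  let ?F = "cyclotomic_field (Coset.order G)" and ?e = "cyclotomic_exponent (Coset.order G)"
  let ?act = "\<lambda>\<sigma> C. \<Union>x\<in>C. conj_class G (x [^] ?e \<sigma>)"
  have ord: "Coset.order G > 0" using fin by (simp add: order_gt_0_iff_finite)
  obtain A where A: "A \<subseteq> ring_iso ?F ?F"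
    and "K \<in> {\<Union>Q | Q. Q \<in> orbits (BijGroup (carrier ?F)\<lparr>carrier := A\<rparr>) (conj_classes G) ?act}"
    using T K(1) unfolding ACSup_def Let_def by auto
  then obtain c where c: "c \<in> carrier G"
    and "K = \<Union> (orbit (BijGroup (carrier ?F)\<lparr>carrier := A\<rparr>) ?act {c})"
    by (auto simp: orbits_def conj_classes_comm)
  then have "K = {c [^] ?e \<sigma> | \<sigma>. \<sigma> \<in> A}" by (auto simp: orbit_def conj_class_comm)
  then obtain \<sigma> \<tau> where \<sigma>: "\<sigma> \<in> A" "x = c [^] ?e \<sigma>" and \<tau>: "y = c [^] ?e \<tau>"
    using K by auto
  have "c [^] n = \<one>"
    using pow_coprime_eq_one[OF c cyclotomic_exponent_coprime[OF ord]] \<sigma> A n c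
    by (auto simp: nat_pow_pow)
  then have "c [^] (n * ?e \<tau>) = \<one>" using c by (simp flip: nat_pow_pow)
  then show ?thesis unfolding \<tau> using c by (simp add: nat_pow_pow mult.commute)
qed

text \<open>A superclass of the product comes either from the theory of \<open>N\<close>, whose
  superclasses partition \<open>N\<close>, or from the quotient, and then it is a union of cosets of
  \<open>N\<close>.\<close>

lemma (in group) Sup_star_at_superclass:
  assumes N: "N \<lhd> G" and T: "T \<in> Sup_star_at G N"
  shows "C \<in> snd T \<Longrightarrow> C \<subseteq> N \<or> (\<forall>n\<in>N. \<forall>x\<in>C. n \<otimes> x \<in> C)"
    and "x \<in> N \<Longrightarrow> \<exists>C\<in>snd T. x \<in> C \<and> C \<subseteq> N"
proof -
  interpret N: normal N G by fact
  obtain XX KK YY LL where T: "snd T = KK \<union> {\<Union>L | L. L \<in> LL \<and> L \<noteq> {N}}"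
    and K: "partition_on N KK" and L: "partition_on (carrier (G Mod N)) LL"
    using T by (auto simp: Sup_star_at_def SupTh_inv_def SupTh_def star_product_def)
  have coset: "n \<otimes> x \<in> D" if "D \<in> rcosets N" "n \<in> N" "x \<in> D" for n x D
    using that by (force simp: RCOSETS_def r_coset_def m_assoc[symmetric])
  have "n \<otimes> x \<in> \<Union>L" if "L \<in> LL" "n \<in> N" "x \<in> \<Union>L" for n x L
    using that coset partition_onD1[OF L] by (force simp: FactGroup_def)
  then show "C \<in> snd T \<Longrightarrow> C \<subseteq> N \<or> (\<forall>n\<in>N. \<forall>x\<in>C. n \<otimes> x \<in> C)"
    unfolding T using partition_onD1[OF K] by blast
  show "x \<in> N \<Longrightarrow> \<exists>C\<in>snd T. x \<in> C \<and> C \<subseteq> N"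
    unfolding T using partition_onD1[OF K] by blast
qed

section \<open>The normal theory of a direct product\<close>

lemma set_mult_DirProd:
  "(U \<times> V) <#>\<^bsub>A \<times>\<times> B\<^esub> (U' \<times> V') = (U <#>\<^bsub>A\<^esub> U') \<times> (V <#>\<^bsub>B\<^esub> V')"
  by (force simp: set_mult_def)

lemma (in group) set_mult_trivial_or_whole:
  assumes "U \<in> {{\<one>}, carrier G}" "V \<in> {{\<one>}, carrier G}"
  shows "U <#> V \<in> {{\<one>}, carrier G}"
proof -
  have "{\<one>} <#> carrier G = carrier G" "carrier G <#> {\<one>} = carrier G"
    by (auto simp: set_mult_def)
  then show ?thesis
    using assms subgroup_mult_id[OF triv_subgroup] subgroup_mult_id[OF subgroup_self] by auto
qed

text \<open>Products and intersections act separately on the factors, and in each factor the trivial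
  subgroup and the carrier are closed under both. Conversely, the mixed rectangles are generators,
  and the other two are the trivial subgroup and the whole group.\<close>

lemma normal_closure_system_DirProd:
  assumes A: "group A" and B: "group B"
  shows "normal_closure_system (A \<times>\<times> B) {carrier A \<times> {\<one>\<^bsub>B\<^esub>}, {\<one>\<^bsub>A\<^esub>} \<times> carrier B} =
    {U \<times> V | U V. U \<in> {{\<one>\<^bsub>A\<^esub>}, carrier A} \<and> V \<in> {{\<one>\<^bsub>B\<^esub>}, carrier B}}"
    (is "?N = ?R")
proof
  show "?N \<subseteq> ?R"
  proof
    fix N assume "N \<in> ?N"
    then show "N \<in> ?R"
    proof induction
      case (prod N H)
      then obtain U V U' V' where *: "N = U \<times> V" "H = U' \<times> V'"
        "U \<in> {{\<one>\<^bsub>A\<^esub>}, carrier A}" "V \<in> {{\<one>\<^bsub>B\<^esub>}, carrier B}"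
        "U' \<in> {{\<one>\<^bsub>A\<^esub>}, carrier A}" "V' \<in> {{\<one>\<^bsub>B\<^esub>}, carrier B}"
        by blast
      show ?case unfolding *(1,2) set_mult_DirProd
        using group.set_mult_trivial_or_whole[OF A *(3,5)]
          group.set_mult_trivial_or_whole[OF B *(4,6)] by blast
    next
      case (inter N H)
      then obtain U V U' V' where *: "N = U \<times> V" "H = U' \<times> V'"
        "U \<in> {{\<one>\<^bsub>A\<^esub>}, carrier A}" "V \<in> {{\<one>\<^bsub>B\<^esub>}, carrier B}"
        "U' \<in> {{\<one>\<^bsub>A\<^esub>}, carrier A}" "V' \<in> {{\<one>\<^bsub>B\<^esub>}, carrier B}"
        by blast
      have "U \<inter> U' \<in> {{\<one>\<^bsub>A\<^esub>}, carrier A}" "V \<inter> V' \<in> {{\<one>\<^bsub>B\<^esub>}, carrier B}"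
        using *(3-6) monoid.one_closed[OF group.is_monoid[OF A]]
          monoid.one_closed[OF group.is_monoid[OF B]] by auto
      then show ?case unfolding *(1,2) Times_Int_Times by blast
    next
      case triv
      have "{\<one>\<^bsub>A \<times>\<times> B\<^esub>} = {\<one>\<^bsub>A\<^esub>} \<times> {\<one>\<^bsub>B\<^esub>}" by simp
      then show ?case by blast
    qed auto
  qed
  have "carrier A \<times> {\<one>\<^bsub>B\<^esub>} \<in> ?N" "{\<one>\<^bsub>A\<^esub>} \<times> carrier B \<in> ?N"
    by (auto intro: normal_closure_system.base)
  moreover have "{\<one>\<^bsub>A\<^esub>} \<times> {\<one>\<^bsub>B\<^esub>} \<in> ?N" "carrier A \<times> carrier B \<in> ?N"
    using normal_closure_system.triv[of "A \<times>\<times> B"] normal_closure_system.top[of "A \<times>\<times> B"] by auto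
  ultimately show "?R \<subseteq> ?N" by auto
qed

text \<open>The abstract shape of the four rectangles: bottom \<open>i\<close>, top \<open>w\<close>
  and two incomparable elements between. For sets, where \<open><\<close> is proper inclusion, it
  settles which subgroups \<open>normal_circ\<close> removes.\<close>

lemma diamond_strictly_below:
  fixes i p q w :: "'a :: order"
  assumes "i < p" "i < q" "p < w" "q < w" "\<not> p \<le> q" "\<not> q \<le> p"
  shows "{x \<in> {i, p, q, w}. x < i} = {}" "{x \<in> {i, p, q, w}. x < p} = {i}"
    "{x \<in> {i, p, q, w}. x < q} = {i}" "{x \<in> {i, p, q, w}. x < w} = {i, p, q}"
  using assms by (auto dest: less_imp_le order.strict_trans)

lemma normal_circ_DirProd:
  assumes A: "group A" "carrier A \<noteq> {\<one>\<^bsub>A\<^esub>}" and B: "group B" "carrier B \<noteq> {\<one>\<^bsub>B\<^esub>}"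
  defines "S \<equiv> {carrier A \<times> {\<one>\<^bsub>B\<^esub>}, {\<one>\<^bsub>A\<^esub>} \<times> carrier B}"
  shows "normal_circ (A \<times>\<times> B) S ({\<one>\<^bsub>A\<^esub>} \<times> {\<one>\<^bsub>B\<^esub>}) = {(\<one>\<^bsub>A\<^esub>, \<one>\<^bsub>B\<^esub>)}" (is ?c1)
    and "normal_circ (A \<times>\<times> B) S (carrier A \<times> {\<one>\<^bsub>B\<^esub>}) = (carrier A - {\<one>\<^bsub>A\<^esub>}) \<times> {\<one>\<^bsub>B\<^esub>}" (is ?cA)
    and "normal_circ (A \<times>\<times> B) S ({\<one>\<^bsub>A\<^esub>} \<times> carrier B) = {\<one>\<^bsub>A\<^esub>} \<times> (carrier B - {\<one>\<^bsub>B\<^esub>})" (is ?cB)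
    and "normal_circ (A \<times>\<times> B) S (carrier A \<times> carrier B) =
      (carrier A - {\<one>\<^bsub>A\<^esub>}) \<times> (carrier B - {\<one>\<^bsub>B\<^esub>})" (is ?cG)
proof -
  have one: "\<one>\<^bsub>A\<^esub> \<in> carrier A" "\<one>\<^bsub>B\<^esub> \<in> carrier B"
    using A(1) B(1) by (simp_all add: group.is_monoid)
  obtain a where a: "a \<in> carrier A" "a \<noteq> \<one>\<^bsub>A\<^esub>" using A(2) one by blast
  obtain b where b: "b \<in> carrier B" "b \<noteq> \<one>\<^bsub>B\<^esub>" using B(2) one by blast
  have circ: "normal_circ (A \<times>\<times> B) S N = N - \<Union>{H \<in> {{\<one>\<^bsub>A\<^esub>} \<times> {\<one>\<^bsub>B\<^esub>},
      carrier A \<times> {\<one>\<^bsub>B\<^esub>}, {\<one>\<^bsub>A\<^esub>} \<times> carrier B, carrier A \<times> carrier B}. H \<subset> N}" for N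
    unfolding normal_circ_def S_def normal_closure_system_DirProd[OF A(1) B(1)]
    by (rule arg_cong[where f = "\<lambda>X. N - \<Union>X"]) auto
  have lt: "{\<one>\<^bsub>A\<^esub>} \<times> {\<one>\<^bsub>B\<^esub>} \<subset> carrier A \<times> {\<one>\<^bsub>B\<^esub>}" "{\<one>\<^bsub>A\<^esub>} \<times> {\<one>\<^bsub>B\<^esub>} \<subset> {\<one>\<^bsub>A\<^esub>} \<times> carrier B"
    "carrier A \<times> {\<one>\<^bsub>B\<^esub>} \<subset> carrier A \<times> carrier B" "{\<one>\<^bsub>A\<^esub>} \<times> carrier B \<subset> carrier A \<times> carrier B"
    using a b one by auto
  have nle: "\<not> carrier A \<times> {\<one>\<^bsub>B\<^esub>} \<subseteq> {\<one>\<^bsub>A\<^esub>} \<times> carrier B" "\<not> {\<one>\<^bsub>A\<^esub>} \<times> carrier B \<subseteq> carrier A \<times> {\<one>\<^bsub>B\<^esub>}"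
    using a b one by auto
  note below = diamond_strictly_below[OF lt nle]
  show ?c1 ?cA ?cB ?cG unfolding circ below by auto
qed

lemma snd_normal_sct_DirProd:
  assumes A: "group A" "carrier A \<noteq> {\<one>\<^bsub>A\<^esub>}" and B: "group B" "carrier B \<noteq> {\<one>\<^bsub>B\<^esub>}"
  shows "snd (normal_sct (A \<times>\<times> B) {carrier A \<times> {\<one>\<^bsub>B\<^esub>}, {\<one>\<^bsub>A\<^esub>} \<times> carrier B}) =
    {{(\<one>\<^bsub>A\<^esub>, \<one>\<^bsub>B\<^esub>)}, (carrier A - {\<one>\<^bsub>A\<^esub>}) \<times> {\<one>\<^bsub>B\<^esub>}, {\<one>\<^bsub>A\<^esub>} \<times> (carrier B - {\<one>\<^bsub>B\<^esub>}),
     (carrier A - {\<one>\<^bsub>A\<^esub>}) \<times> (carrier B - {\<one>\<^bsub>B\<^esub>})}" (is "snd (normal_sct _ ?S) = ?R")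
proof -
  have one: "\<one>\<^bsub>A\<^esub> \<in> carrier A" "\<one>\<^bsub>B\<^esub> \<in> carrier B"
    using A(1) B(1) by (simp_all add: group.is_monoid)
  have ne: "carrier A - {\<one>\<^bsub>A\<^esub>} \<noteq> {}" "carrier B - {\<one>\<^bsub>B\<^esub>} \<noteq> {}" using A B one by auto
  have "normal_closure_system (A \<times>\<times> B) ?S = {{\<one>\<^bsub>A\<^esub>} \<times> {\<one>\<^bsub>B\<^esub>}, carrier A \<times> {\<one>\<^bsub>B\<^esub>},
      {\<one>\<^bsub>A\<^esub>} \<times> carrier B, carrier A \<times> carrier B}"
    unfolding normal_closure_system_DirProd[OF A(1) B(1)] by auto
  then have "snd (normal_sct (A \<times>\<times> B) ?S) = normal_circ (A \<times>\<times> B) ?S `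
      {{\<one>\<^bsub>A\<^esub>} \<times> {\<one>\<^bsub>B\<^esub>}, carrier A \<times> {\<one>\<^bsub>B\<^esub>}, {\<one>\<^bsub>A\<^esub>} \<times> carrier B, carrier A \<times> carrier B} - {{}}"
    unfolding normal_sct_def by (simp only: snd_conv) blast
  also have "\<dots> = ?R - {{}}"
    by (simp only: image_insert image_empty normal_circ_DirProd[OF A B])
  \<comment> \<open>Each factor has an element other than the identity, so none of the four sets is
    empty.\<close>
  also have "\<dots> = ?R" using ne by auto
  finally show ?thesis .
qed

text \<open>An element of \<open>N\<close> with nontrivial second coordinate moves
  \<open>(a, 1)\<close> out of the superclass \<open>?P\<close>, so \<open>?P\<close> is not a union
  of cosets and must lie in \<open>N\<close>; symmetrically for \<open>?Q\<close>. Together they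
  generate everything.\<close>

lemma normal_sct_DirProd_not_Sup_star_at:
  assumes A: "group A" "carrier A \<noteq> {\<one>\<^bsub>A\<^esub>}" and B: "group B" "carrier B \<noteq> {\<one>\<^bsub>B\<^esub>}"
    and N: "N \<lhd> A \<times>\<times> B" "N \<noteq> {\<one>\<^bsub>A \<times>\<times> B\<^esub>}" "N \<noteq> carrier (A \<times>\<times> B)"
  shows "normal_sct (A \<times>\<times> B) {carrier A \<times> {\<one>\<^bsub>B\<^esub>}, {\<one>\<^bsub>A\<^esub>} \<times> carrier B} \<notin> Sup_star_at (A \<times>\<times> B) N"
    (is "?T \<notin> _")
proof
  assume T: "?T \<in> Sup_star_at (A \<times>\<times> B) N"
  interpret A: group A by fact
  interpret B: group B by fact
  interpret G: group "A \<times>\<times> B" using A(1) B(1) by (rule DirProd_group)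
  have sub: "subgroup N (A \<times>\<times> B)" using N(1) by (rule normal_imp_subgroup)
  let ?P = "(carrier A - {\<one>\<^bsub>A\<^esub>}) \<times> {\<one>\<^bsub>B\<^esub>}" and ?Q = "{\<one>\<^bsub>A\<^esub>} \<times> (carrier B - {\<one>\<^bsub>B\<^esub>})"
    and ?R = "(carrier A - {\<one>\<^bsub>A\<^esub>}) \<times> (carrier B - {\<one>\<^bsub>B\<^esub>})"
  note superclasses = snd_normal_sct_DirProd[OF A B]
  note coset_closed = G.Sup_star_at_superclass(1)[OF N(1) T, unfolded superclasses]
  obtain a where a: "a \<in> carrier A" "a \<noteq> \<one>\<^bsub>A\<^esub>" using A(2) A.one_closed by blast
  obtain b where b: "b \<in> carrier B" "b \<noteq> \<one>\<^bsub>B\<^esub>" using B(2) B.one_closed by blast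
  have P: "?P \<subseteq> N" if "(x, y) \<in> N" "x \<in> carrier A" "y \<in> carrier B" "y \<noteq> \<one>\<^bsub>B\<^esub>" for x y
  proof (rule ccontr)
    assume "\<not> ?P \<subseteq> N"
    then have "(x, y) \<otimes>\<^bsub>A \<times>\<times> B\<^esub> (a, \<one>\<^bsub>B\<^esub>) \<in> ?P" using coset_closed[of ?P] that a by blast
    then show False using that by simp
  qed
  have Q: "?Q \<subseteq> N" if "(x, y) \<in> N" "x \<in> carrier A" "y \<in> carrier B" "x \<noteq> \<one>\<^bsub>A\<^esub>" for x y
  proof (rule ccontr)
    assume "\<not> ?Q \<subseteq> N"
    then have "(x, y) \<otimes>\<^bsub>A \<times>\<times> B\<^esub> (\<one>\<^bsub>A\<^esub>, b) \<in> ?Q" using coset_closed[of ?Q] that b by blast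
    then show False using that by simp
  qed
  have one: "(\<one>\<^bsub>A\<^esub>, \<one>\<^bsub>B\<^esub>) \<in> N" using subgroup.one_closed[OF sub] by simp
  with N(2) obtain x y where xy: "(x, y) \<in> N" "x \<noteq> \<one>\<^bsub>A\<^esub> \<or> y \<noteq> \<one>\<^bsub>B\<^esub>" by auto
  then have car: "x \<in> carrier A" "y \<in> carrier B" using subgroup.subset[OF sub] by auto
  \<comment> \<open>A nontrivial coordinate of \<open>(x, y)\<close> puts one of \<open>?P\<close>,
    \<open>?Q\<close> into \<open>N\<close>; its element \<open>(a, 1)\<close> or
    \<open>(1, b)\<close> then brings in the other.\<close>
  have "?P \<subseteq> N \<and> ?Q \<subseteq> N"
    using xy P[OF xy(1) car] Q[OF xy(1) car] P[of "\<one>\<^bsub>A\<^esub>" b] Q[of a "\<one>\<^bsub>B\<^esub>"] a b by auto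
  then have PQ: "(u, \<one>\<^bsub>B\<^esub>) \<in> N" "(\<one>\<^bsub>A\<^esub>, v) \<in> N" if "u \<in> carrier A" "v \<in> carrier B" for u v
    using that one by (cases "u = \<one>\<^bsub>A\<^esub>"; cases "v = \<one>\<^bsub>B\<^esub>"; auto)+
  have "(u, v) \<in> N" if "u \<in> carrier A" "v \<in> carrier B" for u v
    using subgroup.m_closed[OF sub PQ(1)[OF that] PQ(2)[OF that]] that by simp
  then have "carrier (A \<times>\<times> B) \<subseteq> N" by auto
  then show False using N(3) subgroup.subset[OF sub] by blast
qed

section \<open>The group of order 12\<close>

lemma DirProd_nat_pow: "(x, y) [^]\<^bsub>A \<times>\<times> B\<^esub> (n :: nat) = (x [^]\<^bsub>A\<^esub> n, y [^]\<^bsub>B\<^esub> n)"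
  by (induction n) simp_all

lemma (in group) comm_group_cyclic:
  assumes z: "z \<in> carrier G" "carrier G = generate G {z}" "finite (carrier G)"
  shows "comm_group G"
proof (rule group_comm_groupI)
  fix x y assume "x \<in> carrier G" "y \<in> carrier G"
  then obtain i j :: nat where "x = z [^] i" "y = z [^] j" using cyclic_elems[OF z] by metis
  then show "x \<otimes> y = y \<otimes> x" using z(1) by (simp add: nat_pow_mult add.commute)
qed

lemma (in group) generate_pow_ord:
  assumes a: "a \<in> carrier G" and "ord a \<noteq> 0"
  shows "generate G {a} = (\<lambda>k. a [^] k) ` {..<ord a}"
proof -
  \<comment> \<open>For order 0, which stands for infinite order, truncated subtraction would give
    \<open>{0..0}\<close> instead of the empty set.\<close>
  have "{0..ord a - 1} = {..<ord a}" using assms(2) by auto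
  then show ?thesis
    unfolding generate_pow_nat[OF assms] ord_elems_inf_carrier[OF assms] by auto
qed

text \<open>Superclasses are only half of a theory, so \<open>\<exists>!\<close> justifies speaking
  of the theory with given superclasses. The final clause ranges over nontrivial proper
  \<open>N\<close> because, by \<open>SupTh_subset_Sup_star\<close>, allowing the trivial subgroup
  would make every theory a product.\<close>

theorem mainTheorem5:
  fixes A :: "'a monoid" and B :: "'b monoid" and G :: "('a \<times> 'b) monoid"
    and g :: 'a and h :: 'b
  assumes A: "group A" "g \<in> carrier A" "carrier A = generate A {g}" "group.ord A g = 3"
    and B: "group B" "h \<in> carrier B" "carrier B = generate B {h}" "group.ord B h = 4"
    and G: "G = A \<times>\<times> B"
  shows
    "(\<exists>!T. T \<in> SupTh G \<and> snd T = conj_classes G)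
     \<and> (\<forall>T. T \<in> SupTh G \<and> snd T = conj_classes G \<longrightarrow> T \<in> Sup_star G \<inter> AutSup G \<and> T \<notin> NSup G)
     \<and> \<not> Sup_star G \<inter> AutSup G \<subseteq> NSup G
     \<and> (let S = {generate A {g} \<times> {\<one>\<^bsub>B\<^esub>}, {\<one>\<^bsub>A\<^esub>} \<times> generate B {h}};
            T = normal_sct G S;
            g2 = g [^]\<^bsub>A\<^esub> (2::nat); h2 = h [^]\<^bsub>B\<^esub> (2::nat); h3 = h [^]\<^bsub>B\<^esub> (3::nat)
        in snd T =
             {{(\<one>\<^bsub>A\<^esub>, \<one>\<^bsub>B\<^esub>)},
              {(g, \<one>\<^bsub>B\<^esub>), (g2, \<one>\<^bsub>B\<^esub>)},
              {(\<one>\<^bsub>A\<^esub>, h), (\<one>\<^bsub>A\<^esub>, h2), (\<one>\<^bsub>A\<^esub>, h3)},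
              {(g, h), (g, h2), (g, h3), (g2, h), (g2, h2), (g2, h3)}}
           \<and> T \<notin> AutSup G \<union> ACSup G \<union>
               (\<Union>N\<in>{N. N \<lhd> G \<and> N \<noteq> {\<one>\<^bsub>G\<^esub>} \<and> N \<noteq> carrier G}. Sup_star_at G N))"
proof -
  interpret A: group A by fact
  interpret B: group B by fact
  interpret G: group G unfolding G using A(1) B(1) by (rule DirProd_group)
  define g2 h2 h3 where pow_defs: "g2 = g [^]\<^bsub>A\<^esub> (2::nat)" "h2 = h [^]\<^bsub>B\<^esub> (2::nat)" "h3 = h [^]\<^bsub>B\<^esub> (3::nat)"
  have powA: "g [^]\<^bsub>A\<^esub> k = \<one>\<^bsub>A\<^esub> \<longleftrightarrow> 3 dvd k" and powB: "h [^]\<^bsub>B\<^esub> k = \<one>\<^bsub>B\<^esub> \<longleftrightarrow> 4 dvd k" for k :: nat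
    using A.pow_eq_id[OF A(2)] B.pow_eq_id[OF B(2)] A(4) B(4) by simp_all
  have carA: "carrier A = {\<one>\<^bsub>A\<^esub>, g, g2}" and carB: "carrier B = {\<one>\<^bsub>B\<^esub>, h, h2, h3}"
    unfolding A(3) B(3) A.generate_pow_ord[OF A(2), unfolded A(4), simplified]
      B.generate_pow_ord[OF B(2), unfolded B(4), simplified]
    using A(2) B(2) by (auto simp: pow_defs lessThan_Suc numeral_eq_Suc)
  have neA: "g \<noteq> \<one>\<^bsub>A\<^esub>" "g2 \<noteq> \<one>\<^bsub>A\<^esub>" and neB: "h \<noteq> \<one>\<^bsub>B\<^esub>" "h2 \<noteq> \<one>\<^bsub>B\<^esub>" "h3 \<noteq> \<one>\<^bsub>B\<^esub>"
    using powA[of 1] powA[of 2] powB[of 1] powB[of 2] powB[of 3] A(2) B(2)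
    by (auto simp: pow_defs)
  have nontriv: "carrier A \<noteq> {\<one>\<^bsub>A\<^esub>}" "carrier B \<noteq> {\<one>\<^bsub>B\<^esub>}"
    unfolding carA carB using neA neB by auto
  have fin: "finite (carrier A)" "finite (carrier B)" "finite (carrier G)"
    by (simp_all add: G carA carB)

  define z where "z = (g, h)"
  have z: "z \<in> carrier G" using A(2) B(2) by (simp add: z_def G)
  have gen: "carrier G = generate G {z}"
  proof
    show "generate G {z} \<subseteq> carrier G" using z by (intro G.generate_incl) simp
    show "carrier G \<subseteq> generate G {z}"
    proof
      fix w assume "w \<in> carrier G"
      then obtain x y where w: "w = (x, y)" "x \<in> carrier A" "y \<in> carrier B" by (auto simp: G)
      obtain i j :: nat where ij: "x = g [^]\<^bsub>A\<^esub> i" "y = h [^]\<^bsub>B\<^esub> j"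
        using A.cyclic_elems[OF A(2,3) fin(1) w(2)] B.cyclic_elems[OF B(2,3) fin(2) w(3)] by metis
      \<comment> \<open>Chinese remainder theorem: \<open>4 i + 9 j\<close> is \<open>i\<close> modulo 3 and \<open>j\<close> modulo 4.\<close>
      have "g [^]\<^bsub>A\<^esub> (3 * m + i) = x" "h [^]\<^bsub>B\<^esub> (4 * m + j) = y" for m
        using A(2) B(2) powA[of "3 * m"] powB[of "4 * m"]
        by (simp_all add: ij A.nat_pow_mult[symmetric] B.nat_pow_mult[symmetric])
      \<comment> \<open>The instances come from
        \<open>4 i + 9 j = 3 (i + 3 j) + i = 4 (i + 2 j) + j\<close>.\<close>
      from this(1)[of "i + 3 * j"] this(2)[of "i + 2 * j"]
      have "w = z [^]\<^bsub>G\<^esub> (4 * i + 9 * j)"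
        unfolding w z_def G DirProd_nat_pow by (simp add: add.commute)
      then show "w \<in> generate G {z}"
        using G.generate_pow_on_finite_carrier[OF fin(3) z] by blast
    qed
  qed
  interpret G: comm_group G by (rule G.comm_group_cyclic[OF z gen fin(3)])

  define D where "D = ((\<lambda>\<psi>. {\<psi>}) ` Irr G, conj_classes G)"
  have SupTh: "T \<in> SupTh G \<and> snd T = conj_classes G \<longleftrightarrow> T = D" for T
    unfolding D_def by (rule G.SupTh_conj_classes_cyclic[OF z gen fin(3)])
  have D: "D \<in> SupTh G" "snd D = conj_classes G" using SupTh by blast+
  \<comment> \<open>Squaring \<open>z\<close> squares its first coordinate \<open>g\<close>, which
    has order 3.\<close>
  have "inv\<^bsub>G\<^esub> z \<noteq> z"
  proof
    assume "inv\<^bsub>G\<^esub> z = z"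
    then have "z \<otimes>\<^bsub>G\<^esub> z = \<one>\<^bsub>G\<^esub>" using G.r_inv[OF z] by simp
    then have "z [^]\<^bsub>G\<^esub> (2::nat) = \<one>\<^bsub>G\<^esub>" using z by (simp add: numeral_2_eq_2)
    then show False using neA(2) by (simp add: z_def G DirProd_nat_pow pow_defs)
  qed
  then have "D \<notin> NSup G" using G.NSup_superclasses_ne_conj_classes[OF z] D(2) by blast
  \<comment> \<open>Here the product is the one over the trivial subgroup.\<close>
  moreover have "D \<in> Sup_star G" using SupTh_subset_Sup_star[OF G.is_group] D(1) by blast
  moreover have "D \<in> AutSup G" unfolding D_def by (rule G.singletons_conj_classes_AutSup)
  ultimately have D': "D \<in> Sup_star G \<inter> AutSup G" "D \<notin> NSup G" by blast+

  define T where "T = normal_sct G {generate A {g} \<times> {\<one>\<^bsub>B\<^esub>}, {\<one>\<^bsub>A\<^esub>} \<times> generate B {h}}"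
  have T: "T = normal_sct (A \<times>\<times> B) {carrier A \<times> {\<one>\<^bsub>B\<^esub>}, {\<one>\<^bsub>A\<^esub>} \<times> carrier B}"
    unfolding T_def G A(3) B(3) ..
  have "carrier A - {\<one>\<^bsub>A\<^esub>} = {g, g2}" "carrier B - {\<one>\<^bsub>B\<^esub>} = {h, h2, h3}"
    unfolding carA carB using neA neB by auto
  then have sndT: "snd T = {{(\<one>\<^bsub>A\<^esub>, \<one>\<^bsub>B\<^esub>)}, {(g, \<one>\<^bsub>B\<^esub>), (g2, \<one>\<^bsub>B\<^esub>)},
      {(\<one>\<^bsub>A\<^esub>, h), (\<one>\<^bsub>A\<^esub>, h2), (\<one>\<^bsub>A\<^esub>, h3)},
      {(g, h), (g, h2), (g, h3), (g2, h), (g2, h2), (g2, h3)}}"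
    unfolding T snd_normal_sct_DirProd[OF A(1) nontriv(1) B(1) nontriv(2)]
    by (simp add: insert_Times_insert)
  have K: "{(\<one>\<^bsub>A\<^esub>, h), (\<one>\<^bsub>A\<^esub>, h2), (\<one>\<^bsub>A\<^esub>, h3)} \<in> snd T" unfolding sndT by blast
  \<comment> \<open>Two members of one superclass with different orders: \<open>h\<close> has order
    4 and its square \<open>h2\<close> has order 2.\<close>
  have h2: "(\<one>\<^bsub>A\<^esub>, h2) [^]\<^bsub>G\<^esub> (2::nat) = \<one>\<^bsub>G\<^esub>" and h: "(\<one>\<^bsub>A\<^esub>, h) [^]\<^bsub>G\<^esub> (2::nat) \<noteq> \<one>\<^bsub>G\<^esub>"
    using powB[of 4] powB[of 2] B(2) by (simp_all add: G DirProd_nat_pow pow_defs B.nat_pow_pow)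
  have "T \<notin> AutSup G" using G.AutSup_superclass_pow[OF _ K _ _ h2, of "(\<one>\<^bsub>A\<^esub>, h)"] h by auto
  moreover have "T \<notin> ACSup G"
    using G.ACSup_superclass_pow[OF fin(3) _ K _ _ h2, of "(\<one>\<^bsub>A\<^esub>, h)"] h by auto
  moreover have "T \<notin> (\<Union>N\<in>{N. N \<lhd> G \<and> N \<noteq> {\<one>\<^bsub>G\<^esub>} \<and> N \<noteq> carrier G}. Sup_star_at G N)"
    unfolding T G
    using normal_sct_DirProd_not_Sup_star_at[OF A(1) nontriv(1) B(1) nontriv(2)] by blast
  ultimately show ?thesis
    unfolding Let_def T_def[symmetric] pow_defs[symmetric] sndT SupTh using D' by blast
qed

end
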